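(* Let $n\ge1$ be an integer. Consider the problem of finding a monic polynomial $P$ (with complex coefficients) of degree exactly $n$ and a vector of complex constants $\boldsymbol{c}=(c_j)_{j\in\{1,\dots,D-1\}\setminus\{D/2\}}$ such that, for all integers $0\le k\le n+D-3$, $$\int_{\mathbb{R}}x^kP(x)e^{-V(x)}\,dx+\sum_{\substack{j=1\\ j\ne D/2}}^{D-1}c_j\Big\{\int_0^{\infty_{2j}}Y_{2j}(z)e^{-\frac12V(z)}z^k\,dz-\beta_j\int_0^{\infty_0}Y_0(z)e^{-\frac12V(z)}z^k\,dz-\kappa_j\int_0^{\infty_D}Y_D(z)e^{-\frac12V(z)}z^k\,dz\Big\}=0 .$$ Then this problem has a unique solution $(P,\boldsymbol{c})$, where $P=P_n$.
   Context: Standing assumptions: $D\ge 4$ is an even integer, $\lambda>0$, and $V$ is a real polynomial with $V(x)=\gamma x^D+\mathcal{O}(x^{D-1})$, $\gamma>0$. Sobolev orthogonal polynomials: $\langle P,Q\rangle_S=\int_{\mathbb{R}}P(x)Q(x)e^{-V(x)}dx+\lambda\int_{\mathbb{R}}P'(x)Q'(x)e^{-V(x)}dx$ on real polynomials. $P_n$ ($n\ge0$) is the unique monic polynomial of degree $n$ such that $\langle P_n,P_m\rangle_S=0$ for all $n\ne m$. Sibuya solutions: let $\varphi(z)=(\gamma^{-1}V(z))^{1/D}$ on a neighbourhood of infinity, with the branch such that $\varphi(z)=z(1+\mathcal{O}(z^{-1}))$ as $z\to\infty$, and let $\varphi^{-1}$ be its inverse near infinity. Fix $\varrho>0$ sufficiently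 large that $\varphi$ and $\varphi^{-1}$ are both injective on $\{|z|>\frac12\varrho\}$, $\frac12|z|\le|\varphi(z)|\le 2|z|$ for $|z|\ge\varrho$, and $\frac{(D-1)\varrho^{-D}}{\gamma D}\le\frac12$. For $k\in\{0,\dots,2D-1\}$ put $\Omega_k=\varphi^{-1}\big(\{w\in\mathbb{C}:|w|\ge\varrho,\ \pi\frac{k-1}{D}\le\arg w\le\pi\frac{k+1}{D}\}\big)$ (arguments modulo $2\pi$). $F_k$ is the unique entire function with $(-1)^kV'F_k'-F_k''+\lambda^{-1}F_k=0$ on $\mathbb{C}$ and $F_k(z)=1+\mathcal{O}(|z|^{2-D})$ as $|z|\to\infty$, $z\in\Omega_k$. Define $Y_k(z)=i^k e^{-i\pi/4}e^{-\frac12V(z)}F_k(z)$ for $k$ even and $Y_k(z)=i^ke^{-i\pi/4}\lambda\,e^{\frac12V(z)}F_k'(z)$ for $k$ odd. Wronskians: $W[f,g]=fg'-f'g$. The Wronskians $W[Y_k,Y_j]$ are constants and $W[Y_0,Y_D]\ne0$. For $j\in\{1,\dots,D-1\}\setminus\{D/2\}$: $\beta_j=-\frac{W[Y_D,Y_{2j}]}{W[Y_0,Y_D]}$ and $\kappa_j=\frac{W[Y_0,Y_{2j}]}{W[Y_0,Y_D]}$. Integrals $\int_0^{\infty_k}$ are taken along the ray from $0$ to $\infty_k:=e^{i\pi k/D}\infty$ (so $\infty_0=+\infty$, $\infty_D=-\infty$). *)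

theory Defs
  imports
    "HOL-Complex_Analysis.Complex_Analysis"
    "HOL-Computational_Algebra.Polynomial"
    "HOL-Library.FuncSet"
    "HOL-Library.Landau_Symbols"
begin

abbreviation cpoly :: "real poly \<Rightarrow> complex poly" where
  "cpoly p \<equiv> map_poly complex_of_real p"

definition sobolev_inner :: "real poly \<Rightarrow> real \<Rightarrow> real poly \<Rightarrow> real poly \<Rightarrow> real" where
  "sobolev_inner V lam P Q =
     (LBINT x. poly P x * poly Q x * exp (- poly V x))
     + lam * (LBINT x. poly (pderiv P) x * poly (pderiv Q) x * exp (- poly V x))"

definition is_sobolev_orthogonal :: "real poly \<Rightarrow> real \<Rightarrow> (nat \<Rightarrow> real poly) \<Rightarrow> bool" where
  "is_sobolev_orthogonal V lam p \<longleftrightarrow>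
     (\<forall>n. degree (p n) = n \<and> lead_coeff (p n) = 1) \<and>
     (\<forall>n m. n \<noteq> m \<longrightarrow> sobolev_inner V lam (p n) (p m) = 0)"

definition sobolev_poly :: "real poly \<Rightarrow> real \<Rightarrow> nat \<Rightarrow> real poly" where
  "sobolev_poly V lam = (THE p. is_sobolev_orthogonal V lam p)"

text \<open>
  The function \<open>phi\<close> is the branch of the \<open>D\<close>-th root of \<open>V / \<gamma>\<close> that is asymptotic to the
  identity, and \<open>psi\<close> is its inverse near infinity. Both are required to be defined, that is
  holomorphic, on \<open>norm z > rho / 2\<close>. By the identity theorem the conditions below determine
  both functions there; their values elsewhere are not constrained and play no role.
\<close>
definition root_coordinates ::
  "real poly \<Rightarrow> real \<Rightarrow> (complex \<Rightarrow> complex) \<Rightarrow> (complex \<Rightarrow> complex) \<Rightarrow> bool" where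
  "root_coordinates V rho phi psi \<longleftrightarrow>
     (let D = degree V; \<gamma> = lead_coeff V; U = {z. norm z > rho / 2} in
       rho > 0 \<and>
       phi holomorphic_on U \<and>
       (\<forall>z\<in>U. phi z ^ D = poly (cpoly V) z / complex_of_real \<gamma>) \<and>
       (\<lambda>z. phi z / z - 1) \<in> O[at_infinity](\<lambda>z. 1 / z) \<and>
       psi holomorphic_on U \<and>
       (\<forall>\<^sub>F z in at_infinity. psi (phi z) = z) \<and>
       (\<forall>\<^sub>F w in at_infinity. phi (psi w) = w) \<and>
       inj_on phi U \<and> inj_on psi U \<and>
       (\<forall>z. norm z \<ge> rho \<longrightarrow> norm z / 2 \<le> norm (phi z) \<and> norm (phi z) \<le> 2 * norm z) \<and>
       (real D - 1) * rho powi (- int D) / (\<gamma> * real D) \<le> 1 / 2)"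

definition sibuya_sector :: "nat \<Rightarrow> real \<Rightarrow> (complex \<Rightarrow> complex) \<Rightarrow> nat \<Rightarrow> complex set" where
  "sibuya_sector D rho psi k =
     psi ` {complex_of_real r * cis \<theta> | r \<theta>.
              rho \<le> r \<and> pi * (real k - 1) / real D \<le> \<theta> \<and> \<theta> \<le> pi * (real k + 1) / real D}"

definition is_sibuya_solution ::
  "real poly \<Rightarrow> real \<Rightarrow> real \<Rightarrow> (complex \<Rightarrow> complex) \<Rightarrow> nat \<Rightarrow> (complex \<Rightarrow> complex) \<Rightarrow> bool" where
  "is_sibuya_solution V lam rho psi k F \<longleftrightarrow>
     F holomorphic_on UNIV \<and>
     (\<forall>z. (-1) ^ k * poly (cpoly (pderiv V)) z * deriv F z - deriv (deriv F) z
            + F z / complex_of_real lam = 0) \<and>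
     (\<lambda>z. F z - 1)
       \<in> O[inf at_infinity (principal (sibuya_sector (degree V) rho psi k))](\<lambda>z.
       complex_of_real (norm z powi (2 - int (degree V))))"

definition sibuya_Y ::
  "real poly \<Rightarrow> real \<Rightarrow> (nat \<Rightarrow> complex \<Rightarrow> complex) \<Rightarrow> nat \<Rightarrow> complex \<Rightarrow> complex" where
  "sibuya_Y V lam F k z =
     (if even k
      then \<i> ^ k * cis (- pi / 4) * exp (- poly (cpoly V) z / 2) * F k z
      else \<i> ^ k * cis (- pi / 4) * complex_of_real lam * exp (poly (cpoly V) z / 2) * deriv (F k) z)"

definition wronskian :: "(complex \<Rightarrow> complex) \<Rightarrow> (complex \<Rightarrow> complex) \<Rightarrow> complex \<Rightarrow> complex" where
  "wronskian f g z = f z * deriv g z - deriv f z * g z"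

text \<open>
  The Wronskians of the functions \<open>sibuya_Y V lam F k\<close> do not depend on the point; the connection
  coefficients take their value at the origin.
\<close>
definition sibuya_beta ::
  "real poly \<Rightarrow> real \<Rightarrow> (nat \<Rightarrow> complex \<Rightarrow> complex) \<Rightarrow> nat \<Rightarrow> complex" where
  "sibuya_beta V lam F j =
     (let D = degree V; Y = sibuya_Y V lam F
      in - (wronskian (Y D) (Y (2 * j)) 0 / wronskian (Y 0) (Y D) 0))"

definition sibuya_kappa ::
  "real poly \<Rightarrow> real \<Rightarrow> (nat \<Rightarrow> complex \<Rightarrow> complex) \<Rightarrow> nat \<Rightarrow> complex" where
  "sibuya_kappa V lam F j =
     (let D = degree V; Y = sibuya_Y V lam F
      in wronskian (Y 0) (Y (2 * j)) 0 / wronskian (Y 0) (Y D) 0)"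

text \<open>Integral of \<open>g\<close> along the ray from \<open>0\<close> to infinity in direction \<open>cis (pi * k / D)\<close>.\<close>
definition ray_integral :: "nat \<Rightarrow> nat \<Rightarrow> (complex \<Rightarrow> complex) \<Rightarrow> complex" where
  "ray_integral D k g =
     (LBINT t:{0..}. g (complex_of_real t * cis (pi * real k / real D)) * cis (pi * real k / real D))"

definition coeff_indices :: "nat \<Rightarrow> nat set" where
  "coeff_indices D = {1..D - 1} - {D div 2}"

text \<open>
  The vector \<open>c\<close> is an extensional function on the index set, so that equality of functions is
  equality of vectors.
\<close>
definition solves_moment_problem ::
  "real poly \<Rightarrow> real \<Rightarrow> (nat \<Rightarrow> complex \<Rightarrow> complex) \<Rightarrow> nat \<Rightarrow>
   complex poly \<Rightarrow> (nat \<Rightarrow> complex) \<Rightarrow> bool" where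
  "solves_moment_problem V lam F n P c \<longleftrightarrow>
     (let D = degree V;
          Y = sibuya_Y V lam F;
          I = (\<lambda>m k. ray_integral D m (\<lambda>z. Y m z * exp (- poly (cpoly V) z / 2) * z ^ k))
      in
       degree P = n \<and> lead_coeff P = 1 \<and>
       c \<in> coeff_indices D \<rightarrow>\<^sub>E UNIV \<and>
       (\<forall>k \<le> n + D - 3.
          (LBINT x. complex_of_real x ^ k * poly P (complex_of_real x)
                      * complex_of_real (exp (- poly V x)))
          + (\<Sum>j\<in>coeff_indices D.
               c j * (I (2 * j) k - sibuya_beta V lam F j * I 0 k - sibuya_kappa V lam F j * I D k))
          = 0))"

end

theory Submission
  imports Defs
begin

text \<open>
  Write \<open>L Q = Q + \<lambda> (V' Q' - Q'')\<close>. Integration by parts on the real line turns the Sobolev product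
  into an ordinary weighted one, \<open>\<langle>P, Q\<rangle> = \<integral> P \<cdot> L Q \<cdot> exp (- V)\<close>. So if the functional in the moment problem is
  tested on \<open>L Q\<close> and the terms with the constants \<open>c\<^sub>j\<close> drop out, what is left is Sobolev orthogonality.

  They do drop out. If \<open>F\<close> solves \<open>V' F' - F'' + F / \<lambda> = 0\<close>, then \<open>exp (- V) F \<cdot> L Q\<close> is the derivative of
  \<open>\<lambda> exp (- V) (F' Q - F Q')\<close>. A Sibuya solution of even index and its derivative are bounded on the central
  ray of the sector, where \<open>exp (- V)\<close> decays faster than any \<open>exp (- a t)\<close>, so the ray integral of \<open>L Q\<close> is a
  boundary term at \<open>0\<close>, linear in the values \<open>Y 0\<close> and \<open>Y' 0\<close>. Since \<open>W[Y\<^sub>0, Y\<^sub>D] \<noteq> 0\<close>, Cramer's rule says that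
  \<open>Y\<^sub>2\<^sub>j - \<beta>\<^sub>j Y\<^sub>0 - \<kappa>\<^sub>j Y\<^sub>D\<close> vanishes to second order at \<open>0\<close>, and the boundary terms cancel
  (\<open>loop_functional_sobolev_op\<close>).

  As \<open>L\<close> maps degree \<open>m \<ge> 1\<close> to degree \<open>m + D - 2\<close> and fixes the constants, polynomials of degree at most
  \<open>n + D - 3\<close> contain the image under \<open>L\<close> of those of degree below \<open>n\<close> with codimension \<open>D - 2\<close>, which is the
  number of constants \<open>c\<^sub>j\<close>. The conditions form a square linear system, and existence follows from
  uniqueness. Uniqueness of \<open>P\<close> is positivity of the Sobolev product. Uniqueness of \<open>c\<close> means that the \<open>D - 2\<close>
  functionals are linearly independent on polynomials of degree at most \<open>D - 2\<close>. Every polynomial is the sum of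
  such a polynomial and of an element of the image of \<open>L\<close>, hence it is enough to prove independence on all
  polynomials.

  This is an instance of a statement about stars (\<open>star_moments_determine_coefficients\<close>): let \<open>f\<^sub>m \<rightarrow> 1\<close> be
  bounded continuous functions on the \<open>D\<close> rays where \<open>z ^ D > 0\<close>; if \<open>\<Sum>\<^sub>m a\<^sub>m \<integral> exp (- V) f\<^sub>m p = 0\<close> for all polynomials \<open>p\<close>,
  then all \<open>a\<^sub>m\<close> vanish. By dominated convergence \<open>p\<close> may be replaced by \<open>exp q\<close> with \<open>q\<close> of degree below \<open>D\<close>.
  The choice \<open>q z = (V z - \<gamma> z ^ D) + s z / \<omega>\<^sub>l\<close> removes the oscillating lower order terms of \<open>V\<close>, and leaves
  the positive weight \<open>exp (- \<gamma> t ^ D)\<close> on every ray, multiplied by \<open>exp (s t)\<close> on ray \<open>l\<close> and by an exponential of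
  smaller modulus on the others. As \<open>s \<rightarrow> \<infinity>\<close> ray \<open>l\<close> dominates and \<open>a\<^sub>l = 0\<close>.
\<close>

section \<open>Square linear systems\<close>

text \<open>
  Gaussian elimination: an equation with a nonzero coefficient is solved for the corresponding unknown,
  which leaves one equation and one unknown fewer.
\<close>
lemma ex_nontrivial_solution_underdetermined:
  fixes A :: "'k \<Rightarrow> 'i \<Rightarrow> 'a::field"
  assumes "finite K" "finite I" "card K < card I"
  shows "\<exists>x. (\<exists>i\<in>I. x i \<noteq> 0) \<and> (\<forall>k\<in>K. (\<Sum>i\<in>I. A k i * x i) = 0)"
  using assms
proof (induction K arbitrary: I A rule: finite_induct)
  case empty
  then have "I \<noteq> {}" by auto
  then show ?case by (intro exI[of _ "\<lambda>_. 1"]) auto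
next
  case (insert k K)
  show ?case
  proof (cases "\<forall>i\<in>I. A k i = 0")
    case True
    obtain x where "\<exists>i\<in>I. x i \<noteq> 0" "\<forall>l\<in>K. (\<Sum>i\<in>I. A l i * x i) = 0"
      using insert.IH[of I A] insert.prems insert.hyps by auto
    then show ?thesis using True by (intro exI[of _ x]) auto
  next
    case False
    then obtain i0 where i0: "i0 \<in> I" "A k i0 \<noteq> 0" by auto
    define I' where "I' = I - {i0}"
    have I': "I = insert i0 I'" "i0 \<notin> I'" "finite I'" using i0 insert.prems by (auto simp: I'_def)
    have "card K < card I'" using insert.prems insert.hyps I' by simp
    then obtain x where x: "\<exists>i\<in>I'. x i \<noteq> 0"
        "\<forall>l\<in>K. (\<Sum>i\<in>I'. (A l i - A l i0 * A k i / A k i0) * x i) = 0"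
      using insert.IH[of I' "\<lambda>l i. A l i - A l i0 * A k i / A k i0"] I' by auto
    define y where "y = x(i0 := - (\<Sum>i\<in>I'. A k i * x i) / A k i0)"
    have sum_y: "(\<Sum>i\<in>I. A l i * y i) = A l i0 * y i0 + (\<Sum>i\<in>I'. A l i * x i)" for l
    proof -
      have "(\<Sum>i\<in>I'. A l i * y i) = (\<Sum>i\<in>I'. A l i * x i)"
        using I' by (intro sum.cong) (auto simp: y_def)
      then show ?thesis using I' by simp
    qed
    have "(\<Sum>i\<in>I. A l i * y i) = 0" if "l \<in> insert k K" for l
    proof (cases "l = k")
      case True
      then show ?thesis using i0 by (simp only: sum_y) (simp add: y_def)
    next
      case False
      then have "0 = (\<Sum>i\<in>I'. (A l i - A l i0 * A k i / A k i0) * x i)" using x that by auto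
      also have "\<dots> = (\<Sum>i\<in>I'. A l i * x i) - (\<Sum>i\<in>I'. A l i0 / A k i0 * (A k i * x i))"
        by (simp add: algebra_simps sum_subtractf)
      also have "\<dots> = A l i0 * y i0 + (\<Sum>i\<in>I'. A l i * x i)"
        by (simp add: y_def sum_distrib_left sum_divide_distrib)
      finally show ?thesis by (simp only: sum_y)
    qed
    moreover have "\<exists>i\<in>I. y i \<noteq> 0" using x I' by (auto simp: y_def)
    ultimately show ?thesis by blast
  qed
qed

text \<open>
  Adjoining the right-hand side \<open>b\<close> as a further column, indexed by \<open>None\<close>, makes the homogeneous system
  underdetermined. In a nontrivial solution the coefficient of that column cannot be \<open>0\<close>, because the
  original columns are independent.
\<close>
lemma square_system_solvable:
  fixes A :: "'k \<Rightarrow> 'i \<Rightarrow> 'a::field"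
  assumes "finite K" "finite I" "card K = card I"
    and inj: "\<And>x. \<forall>k\<in>K. (\<Sum>i\<in>I. A k i * x i) = 0 \<Longrightarrow> \<forall>i\<in>I. x i = 0"
  shows "\<exists>x. \<forall>k\<in>K. (\<Sum>i\<in>I. A k i * x i) = b k"
proof -
  define A' where "A' = (\<lambda>k. case_option (b k) (A k))"
  have sum_A': "(\<Sum>i\<in>insert None (Some ` I). A' k i * y i) = b k * y None + (\<Sum>i\<in>I. A k i * y (Some i))" for k y
    using assms(2) by (simp add: A'_def sum.reindex)
  have "card K < card (insert None (Some ` I))"
    using assms by (simp add: card_insert_if card_image)
  then obtain y where y: "\<exists>i\<in>insert None (Some ` I). y i \<noteq> 0"
      "\<forall>k\<in>K. b k * y None + (\<Sum>i\<in>I. A k i * y (Some i)) = 0"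
    using ex_nontrivial_solution_underdetermined[of K "insert None (Some ` I)" A'] assms
    unfolding sum_A' by auto
  have nz: "y None \<noteq> 0"
  proof
    assume "y None = 0"
    then have "\<forall>i\<in>I. y (Some i) = 0" using y(2) by (intro inj) auto
    with y(1) \<open>y None = 0\<close> show False by auto
  qed
  have "(\<Sum>i\<in>I. A k i * (- y (Some i) / y None)) = b k" if "k \<in> K" for k
  proof -
    have "(\<Sum>i\<in>I. A k i * (- y (Some i) / y None)) = - (\<Sum>i\<in>I. A k i * y (Some i)) / y None"
      by (simp add: sum_divide_distrib sum_negf)
    also have "\<dots> = b k" using y(2) nz that by (simp add: add_eq_0_iff field_simps)
    finally show ?thesis .
  qed
  then show ?thesis by (intro exI[of _ "\<lambda>i. - y (Some i) / y None"]) auto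
qed

section \<open>Decay of the weight\<close>

lemma set_integrable_exp_minus: "set_integrable lborel {0..} (\<lambda>t::real. exp (- t))"
proof -
  have "(\<lambda>t::real. exp (- (1 * t))) integrable_on {0..}"
    using integrable_on_exp_minus_to_infinity[of 1 0] by simp
  then have "(\<lambda>t::real. exp (- t)) absolutely_integrable_on {0..}"
    by (intro nonnegative_absolutely_integrable_1) auto
  then show ?thesis
    unfolding set_integrable_def
    by (subst (asm) integrable_completion) (auto intro!: borel_measurable_continuous_on_indicator continuous_intros)
qed

lemma set_integrable_exp_decay:
  fixes f :: "real \<Rightarrow> 'a::euclidean_space"
  assumes "continuous_on {0..} f" "\<And>t. t \<ge> 0 \<Longrightarrow> norm (f t) \<le> C * exp (- t)"
  shows "set_integrable lborel {0..} f"
proof (rule set_integrable_bound)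
  show "set_integrable lborel {0..} (\<lambda>t. C * exp (- t))"
    using set_integrable_exp_minus by (simp add: set_integrable_mult_right)
  show "set_borel_measurable lborel {0..} f"
    unfolding set_borel_measurable_def
    using borel_measurable_continuous_on_indicator[of "{0..}" f] assms(1) by simp
  show "AE t in lborel. t \<in> {0..} \<longrightarrow> norm (f t) \<le> norm (C * exp (- t))"
    using assms(2) by (intro AE_I2) (auto intro: order_trans[OF _ abs_ge_self])
qed

lemma norm_poly_le_poly_norm:
  fixes p :: "'a::real_normed_field poly"
  shows "norm (poly p z) \<le> poly (map_poly norm p) (norm z)"
proof (induction p)
  case 0 then show ?case by simp
next
  case (pCons a p)
  have "norm (poly (pCons a p) z) \<le> norm a + norm z * norm (poly p z)"
    by (simp add: norm_mult norm_triangle_le)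
  also have "\<dots> \<le> norm a + norm z * poly (map_poly norm p) (norm z)"
    using pCons.IH by (intro add_left_mono mult_left_mono) auto
  finally show ?case by (simp add: map_poly_pCons)
qed

lemma poly_bounded_above_nonneg:
  fixes g :: "real poly"
  assumes "lead_coeff g < 0"
  shows "\<exists>C. \<forall>t\<ge>0. poly g t \<le> C"
proof -
  have "lead_coeff (- g) > 0" using assms by simp
  then obtain N where N: "\<And>t. t \<ge> N \<Longrightarrow> poly (- g) t \<ge> lead_coeff (- g)"
    using poly_pinfty_gt_lc by blast
  have "bounded (poly g ` {0..N})"
    by (intro compact_imp_bounded compact_continuous_image continuous_intros) auto
  then obtain B where B: "\<And>t. t \<in> {0..N} \<Longrightarrow> norm (poly g t) \<le> B"
    unfolding bounded_iff by blast
  show ?thesis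
  proof (intro exI[of _ "max B 0"] allI impI)
    fix t :: real assume "t \<ge> 0"
    then show "poly g t \<le> max B 0"
      using N[of t] B[of t] assms by (cases "t \<ge> N") auto
  qed
qed

lemma power_le_fact_exp:
  fixes t :: real assumes "t \<ge> 0" shows "t ^ k \<le> fact k * exp t"
proof -
  have "(\<Sum>i\<in>{k}. t ^ i /\<^sub>R fact i) \<le> (\<Sum>i. t ^ i /\<^sub>R fact i)"
    using assms by (intro sum_le_suminf summable_exp_generic) auto
  then have "t ^ k / fact k \<le> exp t" by (simp add: exp_def divide_inverse mult.commute)
  then show ?thesis by (simp add: field_simps)
qed

lemma norm_poly_le_const_exp:
  fixes p :: "'a::real_normed_field poly"
  shows "\<exists>C\<ge>0. \<forall>z. norm (poly p z) \<le> C * exp (norm z)"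
proof (intro exI[of _ "\<Sum>i\<le>degree p. norm (coeff p i) * fact i"] conjI allI)
  fix z :: 'a
  have "norm (poly p z) \<le> (\<Sum>i\<le>degree p. norm (coeff p i * z ^ i))"
    unfolding poly_altdef by (rule norm_sum)
  also have "\<dots> \<le> (\<Sum>i\<le>degree p. norm (coeff p i) * (fact i * exp (norm z)))"
    using power_le_fact_exp[of "norm z"] by (intro sum_mono) (auto simp: norm_mult norm_power intro!: mult_left_mono)
  finally show "norm (poly p z) \<le> (\<Sum>i\<le>degree p. norm (coeff p i) * fact i) * exp (norm z)"
    by (simp add: sum_distrib_right mult.assoc)
qed (auto intro: sum_nonneg)

definition lower_part :: "'a::comm_ring_1 poly \<Rightarrow> 'a poly" where
  "lower_part p = p - monom (lead_coeff p) (degree p)"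

lemma degree_lower_part: "degree p > 0 \<Longrightarrow> degree (lower_part p) < degree p"
proof -
  assume "degree p > 0"
  have "coeff (lower_part p) i = 0" if "i \<ge> degree p" for i
    using that by (cases "i = degree p") (auto simp: lower_part_def coeff_eq_0)
  then show ?thesis using \<open>degree p > 0\<close>
    by (metis leading_coeff_0_iff degree_0 le_less_linear)
qed

lemma poly_lower_part: "poly p z = lead_coeff p * z ^ degree p + poly (lower_part p) z"
  by (simp add: lower_part_def poly_monom)

lemma degree_cpoly [simp]: "degree (cpoly p) = degree p"
  by (rule degree_map_poly) auto

lemma coeff_cpoly [simp]: "coeff (cpoly p) k = complex_of_real (coeff p k)"
  by (simp add: coeff_map_poly)

lemma poly_cpoly_of_real [simp]: "poly (cpoly p) (complex_of_real x) = complex_of_real (poly p x)"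
  by (induction p) (auto simp: map_poly_pCons)

text \<open>
  On a ray with \<open>\<omega> ^ D = 1\<close> the real part of \<open>V\<close> is \<open>\<gamma> t ^ D\<close> up to lower order terms. The factor
  \<open>exp (poly h t)\<close> with \<open>degree h < D\<close> leaves room for polynomial factors, and for the exponentials of
  polynomials of lower degree that serve as test functions.
\<close>
lemma weight_decay_on_ray:
  fixes V h :: "real poly" and \<omega> :: complex
  assumes D: "degree V = D" "D \<ge> 2" and lead: "lead_coeff V > 0"
    and \<omega>: "norm \<omega> = 1" "\<omega> ^ D = 1" and h: "degree h < D"
  shows "\<exists>C\<ge>0. \<forall>t\<ge>0. norm (exp (- poly (cpoly V) (complex_of_real t * \<omega>))) * exp (poly h t) \<le> C * exp (- t)"
proof -
  define l where "l = map_poly norm (lower_part (cpoly V))"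
  define g where "g = h + l + [:0, 1:] - monom (lead_coeff V) D"
  have degl: "degree l < D"
    using degree_lower_part[of "cpoly V"] D by (simp add: l_def degree_map_poly)
  have "coeff (h + l + [:0,1:]) D = 0"
    using degl h D by (auto simp: coeff_eq_0 coeff_pCons split: nat.splits)
  then have cg: "coeff g D = - lead_coeff V" by (simp add: g_def)
  have "degree (h + l + [:0,1:]) \<le> D"
    using degl h D by (intro degree_add_le) auto
  then have "degree g \<le> D" unfolding g_def by (intro degree_diff_le) (auto simp: degree_monom_le)
  with cg lead have "degree g = D" by (metis le_antisym le_degree neg_equal_0_iff_equal less_irrefl)
  then have "lead_coeff g < 0" using cg lead by simp
  then obtain C where C: "\<And>t. t \<ge> 0 \<Longrightarrow> poly g t \<le> C" using poly_bounded_above_nonneg by blast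
  show ?thesis
  proof (intro exI[of _ "exp C"] conjI allI impI)
    fix t :: real assume t: "t \<ge> 0"
    have "poly (cpoly V) (complex_of_real t * \<omega>)
        = complex_of_real (lead_coeff V * t ^ D) + poly (lower_part (cpoly V)) (complex_of_real t * \<omega>)"
      using D \<omega> by (subst poly_lower_part) (simp add: power_mult_distrib)
    then have "- Re (poly (cpoly V) (complex_of_real t * \<omega>))
        = - lead_coeff V * t ^ D - Re (poly (lower_part (cpoly V)) (complex_of_real t * \<omega>))" by simp
    also have "\<dots> \<le> - lead_coeff V * t ^ D + norm (poly (lower_part (cpoly V)) (complex_of_real t * \<omega>))"
      using abs_Re_le_cmod[of "poly (lower_part (cpoly V)) (complex_of_real t * \<omega>)"] by simp
    also have "\<dots> \<le> - lead_coeff V * t ^ D + poly l t"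
      using norm_poly_le_poly_norm[of "lower_part (cpoly V)" "complex_of_real t * \<omega>"] t \<omega>
      by (simp add: l_def norm_mult)
    also have "\<dots> = poly g t - poly h t - t" by (simp add: g_def poly_monom)
    finally have "- Re (poly (cpoly V) (complex_of_real t * \<omega>)) + poly h t \<le> C + - t"
      using C[OF t] by simp
    then have "exp (- Re (poly (cpoly V) (complex_of_real t * \<omega>)) + poly h t) \<le> exp (C + - t)" by simp
    then show "norm (exp (- poly (cpoly V) (complex_of_real t * \<omega>))) * exp (poly h t) \<le> exp C * exp (- t)"
      by (simp only: exp_add norm_exp_eq_Re uminus_complex.sel)
  qed auto
qed

lemma weight_times_poly_decay_on_ray:
  fixes V :: "real poly" and \<omega> :: complex
  assumes "degree V = D" "D \<ge> 2" "lead_coeff V > 0" "norm \<omega> = 1" "\<omega> ^ D = 1"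
  shows "\<exists>C\<ge>0. \<forall>t\<ge>0. norm (exp (- poly (cpoly V) (complex_of_real t * \<omega>)))
           * norm (poly p (complex_of_real t * \<omega>)) \<le> C * exp (- t)"
proof -
  obtain C where C: "C \<ge> 0" "\<And>z. norm (poly p z) \<le> C * exp (norm z)"
    using norm_poly_le_const_exp by blast
  obtain C' where C': "C' \<ge> 0" "\<And>t. t \<ge> 0 \<Longrightarrow>
      norm (exp (- poly (cpoly V) (complex_of_real t * \<omega>))) * exp (poly [:0, 1:] t) \<le> C' * exp (- t)"
    using weight_decay_on_ray[of V D \<omega> "[:0, 1:]"] assms by auto
  show ?thesis
  proof (intro exI[of _ "C * C'"] conjI allI impI)
    fix t :: real assume t: "t \<ge> 0"
    have "norm (exp (- poly (cpoly V) (complex_of_real t * \<omega>))) * norm (poly p (complex_of_real t * \<omega>))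
        \<le> norm (exp (- poly (cpoly V) (complex_of_real t * \<omega>))) * (C * exp t)"
      using C(2)[of "complex_of_real t * \<omega>"] t assms by (intro mult_left_mono) (auto simp: norm_mult)
    also have "\<dots> \<le> C * (C' * exp (- t))"
      using mult_left_mono[OF C'(2)[OF t] C(1)] by (simp add: mult_ac)
    finally show "norm (exp (- poly (cpoly V) (complex_of_real t * \<omega>))) * norm (poly p (complex_of_real t * \<omega>))
        \<le> C * C' * exp (- t)" by (simp add: mult_ac)
  qed (use C C' in auto)
qed

section \<open>Polynomials separate densities on a star\<close>

text \<open>
  The Laplace transform of the positive weight that all rays share once the lower order terms of \<open>V\<close>
  are removed; it is the normalisation against which all other integrals are compared.
\<close>
definition laplace_mass :: "real \<Rightarrow> nat \<Rightarrow> real \<Rightarrow> real" where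
  "laplace_mass \<gamma> D s = (LBINT t:{0..}. exp (s * t - \<gamma> * t ^ D))"

lemma laplace_integrand_decay:
  fixes \<gamma> s :: real
  assumes "\<gamma> > 0" "D \<ge> 2"
  shows "\<exists>C\<ge>0. \<forall>t\<ge>0. exp (s * t - \<gamma> * t ^ D) \<le> C * exp (- t)"
proof -
  have "degree (monom \<gamma> D) = D" using assms by (intro degree_monom_eq) auto
  moreover have "degree [:0, s:] < D" using assms by (intro le_less_trans[OF degree_pCons_le]) simp
  ultimately obtain C :: real where "C \<ge> 0" "\<And>t. t \<ge> 0 \<Longrightarrow>
     norm (exp (- poly (cpoly (monom \<gamma> D)) (complex_of_real t * 1))) * exp (poly [:0, s:] t) \<le> C * exp (- t)"
    using weight_decay_on_ray[of "monom \<gamma> D" D 1 "[:0, s:]"] assms by auto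
  then show ?thesis
    by (intro exI[of _ C]) (auto simp: map_poly_monom poly_monom norm_exp_eq_Re exp_add[symmetric] algebra_simps
        simp flip: of_real_power of_real_mult)
qed

lemma laplace_integrand_integrable:
  fixes \<gamma> s :: real
  assumes "\<gamma> > 0" "D \<ge> 2"
  shows "set_integrable lborel {0..} (\<lambda>t. exp (s * t - \<gamma> * t ^ D))"
proof -
  obtain C where "\<And>t. t \<ge> 0 \<Longrightarrow> exp (s * t - \<gamma> * t ^ D) \<le> C * exp (- t)"
    using laplace_integrand_decay[OF assms] by blast
  then show ?thesis
    by (intro set_integrable_exp_decay[of _ C] continuous_intros) auto
qed

lemma laplace_mass_lower_bound:
  assumes "\<gamma> > 0" "D \<ge> 2" "s \<ge> 0" "R \<ge> 0"
  shows "exp (s * (R + 1)) * exp (- \<gamma> * (R + 2) ^ D) \<le> laplace_mass \<gamma> D s"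
proof -
  let ?c = "exp (s * (R + 1)) * exp (- \<gamma> * (R + 2) ^ D)"
  have "?c = (LBINT t:{R+1..R+2}. ?c)"
    by (simp add: set_integral_const)
  also have "\<dots> \<le> laplace_mass \<gamma> D s"
    unfolding laplace_mass_def set_lebesgue_integral_def
  proof (rule integral_mono)
    show "integrable lborel (\<lambda>t. indicator {0..} t *\<^sub>R exp (s * t - \<gamma> * t ^ D))"
      using laplace_integrand_integrable[OF assms(1,2)] unfolding set_integrable_def .
    show "integrable lborel (\<lambda>t. indicat_real {R+1..R+2} t *\<^sub>R ?c)" by simp
    fix t :: real
    have "?c \<le> exp (s * t - \<gamma> * t ^ D)" if "R + 1 \<le> t" "t \<le> R + 2"
    proof -
      have "s * (R + 1) \<le> s * t" "\<gamma> * t ^ D \<le> \<gamma> * (R + 2) ^ D"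
        using that assms by (auto intro!: mult_left_mono power_mono)
      then show ?thesis by (simp add: exp_add[symmetric])
    qed
    then show "indicat_real {R+1..R+2} t *\<^sub>R ?c \<le> indicator {0..} t *\<^sub>R exp (s * t - \<gamma> * t ^ D)"
      using assms by (auto simp: indicator_def)
  qed
  finally show ?thesis .
qed

lemma laplace_mass_pos: "\<gamma> > 0 \<Longrightarrow> D \<ge> 2 \<Longrightarrow> s \<ge> 0 \<Longrightarrow> laplace_mass \<gamma> D s > 0"
  using laplace_mass_lower_bound[of \<gamma> D s 0] by (rule less_le_trans[rotated]) auto

text \<open>
  The weight has mass beyond every point \<open>R + 1\<close>, so its transform outgrows \<open>exp (s R)\<close>.
\<close>
lemma exp_negligible_vs_laplace_mass:
  assumes "\<gamma> > 0" "D \<ge> 2" "R \<ge> 0"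
  shows "((\<lambda>s. exp (s * R) / laplace_mass \<gamma> D s) \<longlongrightarrow> 0) at_top"
proof (rule tendsto_sandwich[of "\<lambda>_. 0" _ _ "\<lambda>s. exp (\<gamma> * (R + 2) ^ D) * exp (- s)"])
  show "eventually (\<lambda>s. 0 \<le> exp (s * R) / laplace_mass \<gamma> D s) at_top"
    using eventually_ge_at_top[of 0]
  proof eventually_elim
    case (elim s)
    then show ?case using laplace_mass_pos[OF assms(1,2) elim] by simp
  qed
  show "eventually (\<lambda>s. exp (s * R) / laplace_mass \<gamma> D s \<le> exp (\<gamma> * (R + 2) ^ D) * exp (- s)) at_top"
    using eventually_ge_at_top[of 0]
  proof eventually_elim
    case (elim s)
    have "exp (s * R) = exp (\<gamma> * (R + 2) ^ D) * exp (- s) * (exp (s * (R + 1)) * exp (- \<gamma> * (R + 2) ^ D))"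
      by (simp add: exp_add[symmetric] algebra_simps del: exp_add)
    also have "\<dots> \<le> exp (\<gamma> * (R + 2) ^ D) * exp (- s) * laplace_mass \<gamma> D s"
      using laplace_mass_lower_bound[of \<gamma> D s R] assms elim by (intro mult_left_mono) auto
    finally show ?case using laplace_mass_pos[OF assms(1,2) elim] by (simp add: field_simps)
  qed
  have "((\<lambda>s::real. exp (- s)) \<longlongrightarrow> 0) at_top"
    by (rule filterlim_compose[OF exp_at_bot filterlim_uminus_at_bot_at_top])
  then show "((\<lambda>s. exp (\<gamma> * (R + 2) ^ D) * exp (- s)) \<longlongrightarrow> 0) at_top"
    by (rule tendsto_mult_right_zero)
qed auto

text \<open>
  The mechanism of the whole asymptotic argument: a contribution from a bounded part of the ray costs only a
  multiple of some \<open>exp (s R)\<close>, and the rest only has to be small relative to the mass.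
\<close>
lemma negligible_vs_laplace_mass:
  fixes G :: "real \<Rightarrow> complex"
  assumes "\<gamma> > 0" "D \<ge> 2"
    and bound: "\<And>\<epsilon>. \<epsilon> > 0 \<Longrightarrow> \<exists>K R. K \<ge> 0 \<and> R \<ge> 0 \<and>
        (\<forall>s\<ge>0. norm (G s) \<le> \<epsilon> * laplace_mass \<gamma> D s + K * exp (s * R))"
  shows "((\<lambda>s. G s / complex_of_real (laplace_mass \<gamma> D s)) \<longlongrightarrow> 0) at_top"
proof (rule tendstoI)
  fix \<epsilon> :: real assume \<epsilon>: "\<epsilon> > 0"
  then obtain K R where KR: "K \<ge> 0" "R \<ge> 0"
      "\<And>s. s \<ge> 0 \<Longrightarrow> norm (G s) \<le> \<epsilon> / 2 * laplace_mass \<gamma> D s + K * exp (s * R)"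
    using bound[of "\<epsilon> / 2"] by auto
  have "((\<lambda>s. K * (exp (s * R) / laplace_mass \<gamma> D s)) \<longlongrightarrow> 0) at_top"
    using exp_negligible_vs_laplace_mass[OF assms(1,2) KR(2)] by (rule tendsto_mult_right_zero)
  then have "eventually (\<lambda>s. K * (exp (s * R) / laplace_mass \<gamma> D s) < \<epsilon> / 2) at_top"
    using \<epsilon> by (auto dest: order_tendstoD(2)[where a = "\<epsilon>/2"])
  then show "eventually (\<lambda>s. dist (G s / complex_of_real (laplace_mass \<gamma> D s)) 0 < \<epsilon>) at_top"
    using eventually_ge_at_top[of 0]
  proof eventually_elim
    case (elim s)
    have pos: "laplace_mass \<gamma> D s > 0" using laplace_mass_pos[OF assms(1,2)] elim by simp
    have "norm (G s) / laplace_mass \<gamma> D s \<le> \<epsilon> / 2 + K * (exp (s * R) / laplace_mass \<gamma> D s)"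
      using KR(3)[of s] elim pos by (simp add: field_simps)
    also have "\<dots> < \<epsilon>" using elim(1) by linarith
    finally show ?case using pos by (simp add: norm_divide)
  qed
qed

lemma norm_set_lebesgue_integral_le:
  fixes f :: "real \<Rightarrow> complex" and g :: "real \<Rightarrow> real"
  assumes "set_integrable lborel A g" "\<And>t. t \<in> A \<Longrightarrow> norm (f t) \<le> g t"
  shows "norm (LBINT t:A. f t) \<le> (LBINT t:A. g t)"
  unfolding set_lebesgue_integral_def
proof (rule order_trans[OF integral_norm_bound])
  show "(\<integral>t. norm (indicator A t *\<^sub>R f t) \<partial>lborel) \<le> (\<integral>t. indicator A t *\<^sub>R g t \<partial>lborel)"
    using assms(1)[unfolded set_integrable_def] assms(2)
    by (intro integral_mono') (auto simp: indicator_def intro: order_trans[OF norm_ge_zero])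
qed

lemma laplace_average_vanishing:
  fixes u :: "real \<Rightarrow> complex"
  assumes "\<gamma> > 0" "D \<ge> 2" and B: "\<And>t. t \<ge> 0 \<Longrightarrow> norm (u t) \<le> B"
    and lim: "(u \<longlongrightarrow> 0) at_top"
  shows "((\<lambda>s. (LBINT t:{0..}. complex_of_real (exp (s * t - \<gamma> * t ^ D)) * u t)
             / complex_of_real (laplace_mass \<gamma> D s)) \<longlongrightarrow> 0) at_top"
proof (rule negligible_vs_laplace_mass[OF assms(1,2)])
  fix \<epsilon> :: real assume \<epsilon>: "\<epsilon> > 0"
  have B0: "B \<ge> 0" using B[of 0] norm_ge_zero[of "u 0"] by linarith
  obtain R0 where "\<And>t. t \<ge> R0 \<Longrightarrow> norm (u t) < \<epsilon>"
    using tendstoD[OF lim \<epsilon>] by (auto simp: eventually_at_top_linorder)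
  define R where "R = max R0 0"
  have R: "R \<ge> 0" "\<And>t. t \<ge> R \<Longrightarrow> norm (u t) \<le> \<epsilon>"
    using \<open>\<And>t. t \<ge> R0 \<Longrightarrow> norm (u t) < \<epsilon>\<close> by (auto simp: R_def less_imp_le)
  let ?K = "B * laplace_mass \<gamma> D 0"
  have "norm (LBINT t:{0..}. complex_of_real (exp (s * t - \<gamma> * t ^ D)) * u t)
      \<le> \<epsilon> * laplace_mass \<gamma> D s + ?K * exp (s * R)" if s: "s \<ge> 0" for s
  proof -
    let ?g = "\<lambda>t. \<epsilon> * exp (s * t - \<gamma> * t ^ D) + (B * exp (s * R)) * exp (0 * t - \<gamma> * t ^ D)"
    note int = laplace_integrand_integrable[OF assms(1,2)]
    have "norm (LBINT t:{0..}. complex_of_real (exp (s * t - \<gamma> * t ^ D)) * u t) \<le> (LBINT t:{0..}. ?g t)"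
    proof (rule norm_set_lebesgue_integral_le)
      show "set_integrable lborel {0..} ?g"
        by (intro set_integral_add(1) set_integrable_mult_right int)
      fix t :: real assume t: "t \<in> {0..}"
      show "norm (complex_of_real (exp (s * t - \<gamma> * t ^ D)) * u t) \<le> ?g t"
      proof (cases "t \<ge> R")
        case True
        then have "norm (complex_of_real (exp (s * t - \<gamma> * t ^ D)) * u t) \<le> exp (s * t - \<gamma> * t ^ D) * \<epsilon>"
          using R(2)[of t] by (simp add: norm_mult)
        then show ?thesis using B0 by (simp add: mult.commute add_increasing2)
      next
        case False
        have "exp (s * t - \<gamma> * t ^ D) \<le> exp (s * R) * exp (0 * t - \<gamma> * t ^ D)"
          using False s by (simp add: exp_add[symmetric] mult_left_mono)
        then have "exp (s * t - \<gamma> * t ^ D) * norm (u t) \<le> (exp (s * R) * exp (0 * t - \<gamma> * t ^ D)) * B"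
          using B[of t] t by (intro mult_mono) auto
        then have "norm (complex_of_real (exp (s * t - \<gamma> * t ^ D)) * u t) \<le> (B * exp (s * R)) * exp (0 * t - \<gamma> * t ^ D)"
          by (simp add: norm_mult mult_ac)
        then show ?thesis using \<epsilon> by (simp add: add_increasing)
      qed
    qed
    also have "\<dots> = \<epsilon> * laplace_mass \<gamma> D s + (B * exp (s * R)) * laplace_mass \<gamma> D 0"
      unfolding laplace_mass_def
      by (subst set_integral_add(2), (intro set_integrable_mult_right int)+, simp only: set_integral_mult_right)
    finally show ?thesis by (simp add: mult_ac)
  qed
  moreover have "?K \<ge> 0" using B0 laplace_mass_pos[OF assms(1,2), of 0] by simp
  ultimately show "\<exists>K R. K \<ge> 0 \<and> R \<ge> 0 \<and> (\<forall>s\<ge>0.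
      norm (LBINT t:{0..}. complex_of_real (exp (s * t - \<gamma> * t ^ D)) * u t)
      \<le> \<epsilon> * laplace_mass \<gamma> D s + K * exp (s * R))"
    using R(1) by blast
qed

text \<open>
  For large \<open>s\<close> the mass sits far out on the ray, and so the average of \<open>u\<close> tends to its limit at infinity.
\<close>
lemma laplace_average_tendsto:
  fixes u :: "real \<Rightarrow> complex"
  assumes "\<gamma> > 0" "D \<ge> 2" and cont: "continuous_on {0..} u"
    and B: "\<And>t. t \<ge> 0 \<Longrightarrow> norm (u t) \<le> B" and lim: "(u \<longlongrightarrow> L) at_top"
  shows "((\<lambda>s. (LBINT t:{0..}. complex_of_real (exp (s * t - \<gamma> * t ^ D)) * u t)
             / complex_of_real (laplace_mass \<gamma> D s)) \<longlongrightarrow> L) at_top"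
proof -
  let ?w = "\<lambda>s t. complex_of_real (exp (s * t - \<gamma> * t ^ D))"
  let ?J = "\<lambda>s. complex_of_real (laplace_mass \<gamma> D s)"
  have B0: "B \<ge> 0" using B[of 0] norm_ge_zero[of "u 0"] by linarith
  have lim0: "((\<lambda>s. (LBINT t:{0..}. ?w s t * (u t - L)) / ?J s) \<longlongrightarrow> 0) at_top"
  proof (rule laplace_average_vanishing[OF assms(1,2)])
    show "norm (u t - L) \<le> B + norm L" if "t \<ge> 0" for t
      using B[OF that] norm_triangle_ineq4[of "u t" L] by linarith
    show "((\<lambda>t. u t - L) \<longlongrightarrow> 0) at_top" using lim by (simp add: LIM_zero_iff)
  qed
  have eq: "(LBINT t:{0..}. ?w s t * u t) / ?J s = (LBINT t:{0..}. ?w s t * (u t - L)) / ?J s + L"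
    if s: "s \<ge> 0" for s
  proof -
    obtain C where C: "C \<ge> 0" "\<And>t. t \<ge> 0 \<Longrightarrow> exp (s * t - \<gamma> * t ^ D) \<le> C * exp (- t)"
      using laplace_integrand_decay[OF assms(1,2)] by blast
    have int: "set_integrable lborel {0..} (\<lambda>t. ?w s t * u t)"
    proof (rule set_integrable_exp_decay[of _ "C * B"])
      show "continuous_on {0..} (\<lambda>t. ?w s t * u t)" by (intro continuous_intros cont)
      show "norm (?w s t * u t) \<le> C * B * exp (- t)" if "t \<ge> 0" for t
        using mult_mono[OF C(2)[OF that] B[OF that]] C by (simp add: norm_mult mult_ac)
    qed
    have int2: "set_integrable lborel {0..} (\<lambda>t. ?w s t)"
      by (rule set_integrable_exp_decay[of _ C]) (use C in \<open>auto intro!: continuous_intros\<close>)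
    have "(LBINT t:{0..}. ?w s t * (u t - L)) = (LBINT t:{0..}. ?w s t * u t) - (LBINT t:{0..}. ?w s t * L)"
      using int int2 by (subst set_integral_diff(2)[symmetric]) (auto simp: algebra_simps intro!: set_integrable_mult_left)
    also have "(LBINT t:{0..}. ?w s t * L) = ?J s * L"
      by (simp only: set_integral_mult_left set_integral_complex_of_real laplace_mass_def)
    finally show ?thesis using laplace_mass_pos[OF assms(1,2) s] by (simp add: field_simps)
  qed
  show ?thesis
  proof (rule Lim_transform_eventually)
    show "((\<lambda>s. (LBINT t:{0..}. ?w s t * (u t - L)) / ?J s + L) \<longlongrightarrow> L) at_top"
      using tendsto_add[OF lim0 tendsto_const[of L]] by simp
    show "eventually (\<lambda>s. (LBINT t:{0..}. ?w s t * (u t - L)) / ?J s + L = (LBINT t:{0..}. ?w s t * u t) / ?J s) at_top"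
      using eventually_ge_at_top[of 0] by eventually_elim (use eq in auto)
  qed
qed

lemma exp_le_small_multiple:
  fixes c \<epsilon> :: real
  assumes "c < 1" "\<epsilon> > 0"
  shows "\<exists>K\<ge>0. \<forall>x\<ge>0. exp (c * x) \<le> \<epsilon> * exp x + K"
proof -
  define T where "T = max 0 (- ln \<epsilon> / (1 - c))"
  have "exp (c * x) \<le> \<epsilon> * exp x + exp T" if x: "x \<ge> 0" for x
  proof (cases "x \<ge> T")
    case True
    then have "- ln \<epsilon> / (1 - c) \<le> x" by (simp add: T_def)
    then have "- ln \<epsilon> \<le> x * (1 - c)" using assms(1) pos_divide_le_eq[of "1 - c" "- ln \<epsilon>" x] by simp
    then have "c * x \<le> ln \<epsilon> + x" by (simp add: algebra_simps)
    then have "exp (c * x) \<le> exp (ln \<epsilon> + x)" by simp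
    then show ?thesis using assms by (simp add: exp_add add_increasing2)
  next
    case False
    have "c * x \<le> 1 * x" using assms x by (intro mult_right_mono) auto
    then have "exp (c * x) \<le> exp T" using False by simp
    then show ?thesis using assms by (simp add: add_increasing)
  qed
  then show ?thesis by (intro exI[of _ "exp T"]) auto
qed

text \<open>
  With \<open>Re \<tau> < 1\<close> the exponential \<open>exp (s t \<tau>)\<close> is at most a small multiple of \<open>exp (s t)\<close> plus a constant,
  uniformly in \<open>s t\<close>.
\<close>
lemma laplace_average_rotated:
  fixes u :: "real \<Rightarrow> complex"
  assumes "\<gamma> > 0" "D \<ge> 2" and B: "\<And>t. t \<ge> 0 \<Longrightarrow> norm (u t) \<le> B" and \<tau>: "Re \<tau> < 1"
  shows "((\<lambda>s. (LBINT t:{0..}. exp (complex_of_real (s * t) * \<tau> - complex_of_real (\<gamma> * t ^ D)) * u t)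
             / complex_of_real (laplace_mass \<gamma> D s)) \<longlongrightarrow> 0) at_top"
proof (rule negligible_vs_laplace_mass[OF assms(1,2)])
  fix \<epsilon> :: real assume \<epsilon>: "\<epsilon> > 0"
  have B0: "B \<ge> 0" using B[of 0] norm_ge_zero[of "u 0"] by linarith
  have "\<epsilon> / (B + 1) > 0" using \<epsilon> B0 by simp
  then obtain K where K: "K \<ge> 0" "\<And>x. x \<ge> 0 \<Longrightarrow> exp (Re \<tau> * x) \<le> \<epsilon> / (B + 1) * exp x + K"
    using exp_le_small_multiple[OF \<tau>] by blast
  note int = laplace_integrand_integrable[OF assms(1,2)]
  have "norm (LBINT t:{0..}. exp (complex_of_real (s * t) * \<tau> - complex_of_real (\<gamma> * t ^ D)) * u t)
      \<le> \<epsilon> * laplace_mass \<gamma> D s + (B * K * laplace_mass \<gamma> D 0) * exp (s * 0)" if s: "s \<ge> 0" for s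
  proof -
    let ?g = "\<lambda>t. \<epsilon> * exp (s * t - \<gamma> * t ^ D) + (B * K) * exp (0 * t - \<gamma> * t ^ D)"
    have "norm (LBINT t:{0..}. exp (complex_of_real (s * t) * \<tau> - complex_of_real (\<gamma> * t ^ D)) * u t) \<le> (LBINT t:{0..}. ?g t)"
    proof (rule norm_set_lebesgue_integral_le)
      show "set_integrable lborel {0..} ?g"
        by (intro set_integral_add(1) set_integrable_mult_right int)
      fix t :: real assume t: "t \<in> {0..}"
      have "norm (exp (complex_of_real (s * t) * \<tau> - complex_of_real (\<gamma> * t ^ D)) * u t)
          = exp (Re \<tau> * (s * t)) * exp (- \<gamma> * t ^ D) * norm (u t)"
        by (simp add: norm_mult norm_exp_eq_Re exp_add[symmetric] mult_ac)
      also have "\<dots> \<le> ((\<epsilon> / (B + 1) * exp (s * t) + K) * exp (- \<gamma> * t ^ D)) * B"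
        using K s t B[of t] \<epsilon> B0 by (intro mult_mono) auto
      also have "\<dots> = (B / (B + 1)) * (\<epsilon> * (exp (s * t) * exp (- \<gamma> * t ^ D))) + B * K * exp (- \<gamma> * t ^ D)"
        by (simp add: algebra_simps)
      also have "\<dots> = (B / (B + 1)) * (\<epsilon> * exp (s * t - \<gamma> * t ^ D)) + B * K * exp (0 * t - \<gamma> * t ^ D)"
        by (simp add: exp_add[symmetric])
      also have "\<dots> \<le> 1 * (\<epsilon> * exp (s * t - \<gamma> * t ^ D)) + B * K * exp (0 * t - \<gamma> * t ^ D)"
        using B0 \<epsilon> by (intro add_right_mono mult_right_mono) auto
      finally show "norm (exp (complex_of_real (s * t) * \<tau> - complex_of_real (\<gamma> * t ^ D)) * u t) \<le> ?g t" by simp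
    qed
    also have "\<dots> = \<epsilon> * laplace_mass \<gamma> D s + B * K * laplace_mass \<gamma> D 0"
      unfolding laplace_mass_def
      by (subst set_integral_add(2), (intro set_integrable_mult_right int)+, simp only: set_integral_mult_right)
    finally show ?thesis by simp
  qed
  moreover have "B * K * laplace_mass \<gamma> D 0 \<ge> 0" using B0 K laplace_mass_pos[OF assms(1,2), of 0] by simp
  ultimately show "\<exists>K R. K \<ge> 0 \<and> R \<ge> 0 \<and> (\<forall>s\<ge>0.
      norm (LBINT t:{0..}. exp (complex_of_real (s * t) * \<tau> - complex_of_real (\<gamma> * t ^ D)) * u t)
      \<le> \<epsilon> * laplace_mass \<gamma> D s + K * exp (s * R))"
    by blast
qed

definition exp_taylor_poly :: "nat \<Rightarrow> complex poly \<Rightarrow> complex poly" where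
  "exp_taylor_poly N q = (\<Sum>k<N. smult (1 / fact k) (q ^ k))"

lemma poly_exp_taylor_poly: "poly (exp_taylor_poly N q) z = (\<Sum>k<N. poly q z ^ k /\<^sub>R fact k)"
  by (simp add: exp_taylor_poly_def poly_sum scaleR_conv_of_real field_simps)

lemma norm_exp_partial_sum_le:
  fixes x :: complex
  shows "norm (\<Sum>k<N. x ^ k /\<^sub>R fact k) \<le> exp (norm x)"
proof -
  have "norm (\<Sum>k<N. x ^ k /\<^sub>R fact k) \<le> (\<Sum>k<N. norm x ^ k /\<^sub>R fact k)"
    by (rule order_trans[OF norm_sum]) (simp add: norm_power)
  also have "\<dots> \<le> exp (norm x)"
    unfolding exp_def by (intro sum_le_suminf summable_exp_generic) auto
  finally show ?thesis .
qed

text \<open>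
  Functionals that vanish on polynomials also vanish on exponentials of polynomials of degree below \<open>D\<close>:
  the Taylor partial sums of \<open>exp\<close> are dominated by \<open>exp \<bar>q\<bar>\<close>, which \<open>weight_decay_on_ray\<close> controls.
\<close>
lemma integral_exp_taylor_poly_tendsto:
  fixes V :: "real poly" and f :: "real \<Rightarrow> complex" and q :: "complex poly"
  assumes V: "degree V = D" "D \<ge> 2" "lead_coeff V > 0"
    and \<omega>: "norm \<omega> = 1" "\<omega> ^ D = 1"
    and cont: "continuous_on {0..} f" and B: "\<And>t. t \<ge> 0 \<Longrightarrow> norm (f t) \<le> B"
    and q: "degree q < D"
  shows "(\<lambda>N. LBINT t:{0..}. exp (- poly (cpoly V) (complex_of_real t * \<omega>)) * f t
              * poly (exp_taylor_poly N q) (complex_of_real t * \<omega>))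
         \<longlonglongrightarrow> (LBINT t:{0..}. exp (- poly (cpoly V) (complex_of_real t * \<omega>)) * f t
              * exp (poly q (complex_of_real t * \<omega>)))"
proof -
  let ?W = "\<lambda>t. exp (- poly (cpoly V) (complex_of_real t * \<omega>))"
  have B0: "B \<ge> 0" using B[of 0] norm_ge_zero[of "f 0"] by linarith
  obtain C where C: "C \<ge> 0" "\<And>t. t \<ge> 0 \<Longrightarrow> norm (?W t) * exp (poly (map_poly norm q) t) \<le> C * exp (- t)"
    using weight_decay_on_ray[OF V \<omega>, of "map_poly norm q"] q by (auto simp: degree_map_poly)
  have bd: "norm (?W t * f t * x) \<le> B * C * exp (- t)"
    if t: "t \<ge> 0" and x: "norm x \<le> exp (norm (poly q (complex_of_real t * \<omega>)))" for x t
  proof -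
    have "norm x \<le> exp (poly (map_poly norm q) t)"
      using norm_poly_le_poly_norm[of q "complex_of_real t * \<omega>"] t \<omega>
      by (intro order_trans[OF x]) (auto simp: norm_mult)
    then have "norm (?W t * f t * x) \<le> (norm (?W t) * B) * exp (poly (map_poly norm q) t)"
      unfolding norm_mult using B[OF t] B0 by (intro mult_mono) auto
    also have "\<dots> \<le> B * (C * exp (- t))"
      using mult_left_mono[OF C(2)[OF t] B0] by (simp add: mult_ac)
    finally show ?thesis by (simp add: mult_ac)
  qed
  have meas: "(\<lambda>t. indicator {0..} t *\<^sub>R (?W t * f t * g t)) \<in> borel_measurable lborel"
    if "continuous_on {0..} g" for g
    using that by (auto intro!: borel_measurable_continuous_on_indicator continuous_intros cont)
  show ?thesis
    unfolding set_lebesgue_integral_def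
  proof (rule integral_dominated_convergence[where w = "\<lambda>t. indicator {0..} t *\<^sub>R (B * C * exp (- t))"])
    show "(\<lambda>t. indicator {0..} t *\<^sub>R (?W t * f t * exp (poly q (complex_of_real t * \<omega>)))) \<in> borel_measurable lborel"
      by (intro meas continuous_intros)
    show "(\<lambda>t. indicator {0..} t *\<^sub>R (?W t * f t * poly (exp_taylor_poly N q) (complex_of_real t * \<omega>))) \<in> borel_measurable lborel" for N
      by (intro meas continuous_intros)
    show "integrable lborel (\<lambda>t. indicator {0..} t *\<^sub>R (B * C * exp (- t)))"
      using set_integrable_mult_right[OF set_integrable_exp_minus, of "B * C"] unfolding set_integrable_def by simp
    show "AE t in lborel. (\<lambda>N. indicator {0..} t *\<^sub>R (?W t * f t * poly (exp_taylor_poly N q) (complex_of_real t * \<omega>)))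
       \<longlonglongrightarrow> indicator {0..} t *\<^sub>R (?W t * f t * exp (poly q (complex_of_real t * \<omega>)))"
      unfolding poly_exp_taylor_poly
      by (intro AE_I2 tendsto_intros) (use exp_converges in \<open>simp add: sums_def\<close>)
    show "AE t in lborel. norm (indicator {0..} t *\<^sub>R (?W t * f t * poly (exp_taylor_poly N q) (complex_of_real t * \<omega>)))
        \<le> indicator {0..} t *\<^sub>R (B * C * exp (- t))" for N
      unfolding poly_exp_taylor_poly
      using bd[OF _ norm_exp_partial_sum_le] by (intro AE_I2) (auto simp: indicator_def)
  qed
qed

text \<open>
  The test function \<open>exp (q s)\<close> has two tasks: its first summand cancels the lower order part of \<open>V\<close>, whose
  oscillation on a non-real ray would prevent lower bounds for the integrals, and its second summand singles
  out ray \<open>l\<close>, because \<open>Re (\<omega> m * cnj (\<omega> l)) < 1\<close> for \<open>m \<noteq> l\<close>.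
\<close>
theorem star_moments_determine_coefficients:
  fixes V :: "real poly" and \<omega> :: "'i \<Rightarrow> complex" and f :: "'i \<Rightarrow> real \<Rightarrow> complex" and a :: "'i \<Rightarrow> complex"
  assumes V: "degree V = D" "D \<ge> 2" "lead_coeff V > 0"
    and M: "finite M" and \<omega>: "\<And>m. m \<in> M \<Longrightarrow> norm (\<omega> m) = 1" "\<And>m. m \<in> M \<Longrightarrow> \<omega> m ^ D = 1" "inj_on \<omega> M"
    and cont: "\<And>m. m \<in> M \<Longrightarrow> continuous_on {0..} (f m)"
    and bdd: "\<And>m t. m \<in> M \<Longrightarrow> t \<ge> 0 \<Longrightarrow> norm (f m t) \<le> B m"
    and lim: "\<And>m. m \<in> M \<Longrightarrow> (f m \<longlongrightarrow> 1) at_top"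
    and zero: "\<And>p. (\<Sum>m\<in>M. a m * (LBINT t:{0..}. exp (- poly (cpoly V) (complex_of_real t * \<omega> m))
                    * f m t * poly p (complex_of_real t * \<omega> m))) = 0"
    and l: "l \<in> M"
  shows "a l = 0"
proof -
  define \<gamma> where "\<gamma> = lead_coeff V"
  have \<gamma>: "\<gamma> > 0" using V by (simp add: \<gamma>_def)
  define q where "q = (\<lambda>s. lower_part (cpoly V) + [:0, complex_of_real s * cnj (\<omega> l):])"
  define T where "T = (\<lambda>m s. LBINT t:{0..}. exp (complex_of_real (s * t) * (\<omega> m * cnj (\<omega> l)) - complex_of_real (\<gamma> * t ^ D)) * f m t)"
  have degq: "degree (q s) < D" for s
    unfolding q_def using degree_lower_part[of "cpoly V"] V
    by (intro degree_add_less) auto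
  have T_eq: "(LBINT t:{0..}. exp (- poly (cpoly V) (complex_of_real t * \<omega> m)) * f m t
                 * exp (poly (q s) (complex_of_real t * \<omega> m))) = T m s" if m: "m \<in> M" for m s
  proof -
    have "exp (- poly (cpoly V) (complex_of_real t * \<omega> m)) * f m t * exp (poly (q s) (complex_of_real t * \<omega> m))
        = exp (complex_of_real (s * t) * (\<omega> m * cnj (\<omega> l)) - complex_of_real (\<gamma> * t ^ D)) * f m t" for t
    proof -
      have "poly (cpoly V) (complex_of_real t * \<omega> m) = complex_of_real (\<gamma> * t ^ D) + poly (lower_part (cpoly V)) (complex_of_real t * \<omega> m)"
        using V \<omega>(2)[OF m] by (subst poly_lower_part) (simp add: \<gamma>_def power_mult_distrib)
      then have "- poly (cpoly V) (complex_of_real t * \<omega> m) + poly (q s) (complex_of_real t * \<omega> m)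
          = complex_of_real (s * t) * (\<omega> m * cnj (\<omega> l)) - complex_of_real (\<gamma> * t ^ D)"
        by (simp add: q_def algebra_simps)
      then have "exp (- poly (cpoly V) (complex_of_real t * \<omega> m)) * exp (poly (q s) (complex_of_real t * \<omega> m))
          = exp (complex_of_real (s * t) * (\<omega> m * cnj (\<omega> l)) - complex_of_real (\<gamma> * t ^ D))"
        by (simp only: exp_add[symmetric])
      then show ?thesis by (metis mult.assoc mult.commute)
    qed
    then show ?thesis by (simp only: T_def)
  qed
  have sum0: "(\<Sum>m\<in>M. a m * T m s) = 0" for s
  proof (rule LIMSEQ_unique)
    show "(\<lambda>N. \<Sum>m\<in>M. a m * (LBINT t:{0..}. exp (- poly (cpoly V) (complex_of_real t * \<omega> m))
                    * f m t * poly (exp_taylor_poly N (q s)) (complex_of_real t * \<omega> m))) \<longlonglongrightarrow> (\<Sum>m\<in>M. a m * T m s)"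
    proof (intro tendsto_sum tendsto_mult_left)
      fix m assume m: "m \<in> M"
      show "(\<lambda>N. LBINT t:{0..}. exp (- poly (cpoly V) (complex_of_real t * \<omega> m))
                    * f m t * poly (exp_taylor_poly N (q s)) (complex_of_real t * \<omega> m)) \<longlonglongrightarrow> T m s"
        unfolding T_eq[OF m, symmetric]
        by (rule integral_exp_taylor_poly_tendsto[OF V \<omega>(1)[OF m] \<omega>(2)[OF m] cont[OF m] bdd[OF m] degq])
    qed
  qed (simp add: zero)
  let ?J = "\<lambda>s. complex_of_real (laplace_mass \<gamma> D s)"
  have lim_l: "((\<lambda>s. T l s / ?J s) \<longlongrightarrow> 1) at_top"
  proof -
    have "\<omega> l * cnj (\<omega> l) = 1" using \<omega>(1)[OF l] by (simp add: complex_norm_square[symmetric])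
    then have "T l s = (LBINT t:{0..}. complex_of_real (exp (s * t - \<gamma> * t ^ D)) * f l t)" for s
      by (simp add: T_def flip: exp_of_real)
    then show ?thesis
      using laplace_average_tendsto[OF \<gamma> V(2) cont[OF l] bdd[OF l] lim[OF l]] by simp
  qed
  have lim_m: "((\<lambda>s. T m s / ?J s) \<longlongrightarrow> 0) at_top" if m: "m \<in> M" "m \<noteq> l" for m
  proof -
    define \<tau> where "\<tau> = \<omega> m * cnj (\<omega> l)"
    have n1: "norm \<tau> = 1" using \<omega>(1) m l by (simp add: \<tau>_def norm_mult)
    have "\<tau> \<noteq> 1"
    proof
      assume "\<tau> = 1"
      then have "\<omega> m * (cnj (\<omega> l) * \<omega> l) = \<omega> l" by (simp add: \<tau>_def mult.assoc[symmetric])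
      moreover have "cnj (\<omega> l) * \<omega> l = 1" using \<omega>(1)[OF l] by (simp add: complex_norm_square[symmetric] mult.commute)
      ultimately show False using \<omega>(3) m l by (auto simp: inj_on_def)
    qed
    have "Re \<tau> < 1"
    proof (rule ccontr)
      assume "\<not> Re \<tau> < 1"
      moreover have "Re \<tau> \<le> 1" using n1 complex_Re_le_cmod[of \<tau>] by simp
      ultimately have "Re \<tau> = 1" by simp
      moreover then have "Im \<tau> = 0" using n1 by (simp add: cmod_def)
      ultimately show False using \<open>\<tau> \<noteq> 1\<close> by (simp add: complex_eq_iff)
    qed
    then show ?thesis
      using laplace_average_rotated[OF \<gamma> V(2) bdd[OF m(1)], where \<tau>=\<tau>] by (simp add: T_def \<tau>_def)
  qed
  have "((\<lambda>s. \<Sum>m\<in>M. a m * (T m s / ?J s)) \<longlongrightarrow> (\<Sum>m\<in>M. a m * (if m = l then 1 else 0))) at_top"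
    using lim_l lim_m by (intro tendsto_sum tendsto_mult_left) auto
  moreover have "(\<Sum>m\<in>M. a m * (T m s / ?J s)) = 0" for s
    using sum0[of s] by (simp flip: sum_divide_distrib)
  moreover have "(\<Sum>m\<in>M. a m * (if m = l then 1 else 0)) = a l"
    using M l by (simp add: if_distrib[of "(*) _"] sum.delta cong: if_cong)
  ultimately have "((\<lambda>s::real. 0::complex) \<longlongrightarrow> a l) at_top" by simp
  then show ?thesis using tendsto_unique[OF _ tendsto_const] by force
qed

section \<open>Sibuya solutions on their central ray\<close>

text \<open>
  Since \<open>phi z / z \<rightarrow> 1\<close>, the argument of \<open>phi z\<close> near the ray of direction \<open>\<pi> k / D\<close> differs little from
  \<open>\<pi> k / D\<close>, whereas the sector extends to distance \<open>\<pi> / D\<close>. Unit discs, and not only the ray itself, are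
  needed for a Cauchy estimate of the derivative.
\<close>
lemma disc_subset_sibuya_sector:
  assumes rc: "root_coordinates V rho phi psi" and D: "degree V = D" "D > 0"
  shows "\<exists>R. \<forall>t\<ge>R. cball (complex_of_real t * cis (pi * real k / real D)) 1 \<subseteq> sibuya_sector D rho psi k"
proof -
  define \<omega> where "\<omega> = cis (pi * real k / real D)"
  have n\<omega>: "norm \<omega> = 1" by (simp add: \<omega>_def)
  have rho: "rho > 0" and big: "(\<lambda>z. phi z / z - 1) \<in> O[at_infinity](\<lambda>z. 1 / z)"
    and inv: "\<forall>\<^sub>F z in at_infinity. psi (phi z) = z"
    and low: "\<And>z. norm z \<ge> rho \<Longrightarrow> norm z / 2 \<le> norm (phi z)"
    using rc by (auto simp: root_coordinates_def Let_def)
  obtain C where C: "C > 0" "\<forall>\<^sub>F z in at_infinity. norm (phi z / z - 1) \<le> C * norm (1 / z)"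
    using big by (elim landau_o.bigE)
  have "\<forall>\<^sub>F z in at_infinity. psi (phi z) = z \<and> norm (phi z / z - 1) \<le> C * norm (1 / z)"
    using inv C(2) by eventually_elim auto
  then obtain M where M: "\<And>z. norm z \<ge> M \<Longrightarrow> psi (phi z) = z \<and> norm (phi z / z - 1) \<le> C * norm (1 / z)"
    unfolding eventually_at_infinity by blast
  have "isCont Arg 1" by (rule continuous_at_Arg) auto
  then have "\<exists>\<delta>>0. \<forall>u. dist u 1 < \<delta> \<longrightarrow> dist (Arg u) (Arg 1) < pi / real D"
    using D unfolding continuous_at_eps_delta by simp
  then obtain \<delta> where \<delta>: "\<delta> > 0" "\<And>u. norm (u - 1) < \<delta> \<Longrightarrow> \<bar>Arg u\<bar> < pi / real D"
    by (auto simp: dist_norm)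
  define R where "R = Max {2, 2 * M, 4 * rho, (4 * C + 1) / \<delta> + 1}"
  have R: "R \<ge> 2" "R \<ge> 2 * M" "R \<ge> 4 * rho" "R \<ge> (4 * C + 1) / \<delta> + 1"
    unfolding R_def by (intro Max_ge; simp)+
  have "z \<in> sibuya_sector D rho psi k" if t: "t \<ge> R" and z: "norm (z - complex_of_real t * \<omega>) \<le> 1" for t z
  proof -
    have t0: "t > 0" "t \<ge> 2" using t R by auto
    have "t \<le> norm z + 1"
      using norm_triangle_ineq2[of "complex_of_real t * \<omega>" z] z t0 n\<omega> by (simp add: norm_mult norm_minus_commute)
    then have nz: "norm z \<ge> t / 2" using t0 by simp
    then have nz': "norm z \<ge> M" "norm z \<ge> 2 * rho" "norm z > 0" using R t t0 by auto
    have Mz: "psi (phi z) = z" "norm (phi z / z - 1) \<le> C * norm (1 / z)" using M nz'(1) by auto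
    define u where "u = phi z / (complex_of_real t * \<omega>)"
    define v where "v = z / (complex_of_real t * \<omega>)"
    have t\<omega>: "complex_of_real t * \<omega> \<noteq> 0" using t0 n\<omega> by auto
    have "v - 1 = (z - complex_of_real t * \<omega>) / (complex_of_real t * \<omega>)"
      using t\<omega> by (simp add: v_def diff_divide_distrib)
    then have v1: "norm (v - 1) \<le> 1 / t" using z t0 n\<omega> by (simp add: norm_divide norm_mult divide_right_mono)
    then have v2: "norm v \<le> 2"
    proof -
      have "1 / t \<le> 1" using t0 by simp
      then show ?thesis using norm_triangle_ineq[of 1 "v - 1"] v1 by simp
    qed
    \<comment> \<open>\<open>u\<close> is the product of \<open>phi z / z\<close> and \<open>v\<close>, which are both close to \<open>1\<close>\<close>
    have "u - 1 = (phi z / z - 1) * v + (v - 1)"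
    proof -
      have "phi z / z * v = u" using nz'(3) by (simp add: u_def v_def)
      then show ?thesis by (simp add: algebra_simps)
    qed
    then have "norm (u - 1) \<le> norm (phi z / z - 1) * norm v + norm (v - 1)"
      using norm_triangle_ineq[of "(phi z / z - 1) * v" "v - 1"] by (simp only: norm_mult)
    also have "\<dots> \<le> (C * (2 / t)) * 2 + 1 / t"
    proof (intro add_mono mult_mono v1 v2)
      have "norm (1 / z) \<le> 2 / t" using nz nz' t0 by (simp add: norm_divide field_simps)
      then show "norm (phi z / z - 1) \<le> C * (2 / t)"
        using C(1) by (intro order_trans[OF Mz(2)] mult_left_mono) auto
    qed (use C t0 in auto)
    also have "\<dots> = (4 * C + 1) / t" using t0 by (simp add: field_simps)
    also have "\<dots> < \<delta>"
    proof -
      have "(4 * C + 1) / \<delta> < t" using R(4) t by linarith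
      then show ?thesis using \<delta>(1) t0 by (simp add: field_simps)
    qed
    finally have arg: "\<bar>Arg u\<bar> < pi / real D" by (rule \<delta>(2))
    have phi_nz: "norm (phi z) \<ge> rho" using low[of z] nz' rho by linarith
    have "phi z = complex_of_real t * \<omega> * (complex_of_real (norm u) * cis (Arg u))"
      using t\<omega> rcis_cmod_Arg[of u] by (simp add: u_def rcis_def)
    then have "phi z = complex_of_real (t * norm u) * cis (pi * real k / real D + Arg u)"
      by (simp add: \<omega>_def mult_ac flip: cis_mult)
    moreover have "t * norm u = norm (phi z)" using t0 n\<omega> by (simp add: u_def norm_divide norm_mult)
    ultimately have "phi z = complex_of_real (norm (phi z)) * cis (pi * real k / real D + Arg u)" by simp
    moreover have "pi * (real k - 1) / real D \<le> pi * real k / real D + Arg u"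
        "pi * real k / real D + Arg u \<le> pi * (real k + 1) / real D"
      using arg by (auto simp: diff_divide_distrib add_divide_distrib algebra_simps)
    ultimately have "phi z \<in> {complex_of_real r * cis \<theta> | r \<theta>.
        rho \<le> r \<and> pi * (real k - 1) / real D \<le> \<theta> \<and> \<theta> \<le> pi * (real k + 1) / real D}"
      using phi_nz by blast
    then show ?thesis unfolding sibuya_sector_def by (rule image_eqI[where f = psi, OF Mz(1)[symmetric]])
  qed
  then show ?thesis by (intro exI[of _ R]) (auto simp: \<omega>_def dist_norm norm_minus_commute)
qed

text \<open>
  The prescribed asymptotics hold on unit discs around far points of the ray. They give the limit at once, and
  the bound for the derivative by Cauchy's inequality.
\<close>
lemma sibuya_solution_on_ray:
  assumes rc: "root_coordinates V rho phi psi" and D: "degree V = D" "D \<ge> 3"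
    and sol: "is_sibuya_solution V lam rho psi k F"
  shows "((\<lambda>t. F (complex_of_real t * cis (pi * real k / real D))) \<longlongrightarrow> 1) at_top"
    and "\<exists>B. \<forall>t\<ge>0. norm (F (complex_of_real t * cis (pi * real k / real D))) \<le> B
               \<and> norm (deriv F (complex_of_real t * cis (pi * real k / real D))) \<le> B"
proof -
  define \<omega> where "\<omega> = cis (pi * real k / real D)"
  have n\<omega>: "norm \<omega> = 1" by (simp add: \<omega>_def)
  have hol: "F holomorphic_on UNIV" and
     "(\<lambda>z. F z - 1) \<in> O[inf at_infinity (principal (sibuya_sector D rho psi k))](\<lambda>z.
       complex_of_real (norm z powi (2 - int D)))"
    using sol D by (auto simp: is_sibuya_solution_def)
  then obtain C where C: "C > 0" "\<forall>\<^sub>F z in inf at_infinity (principal (sibuya_sector D rho psi k)).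
      norm (F z - 1) \<le> C * norm (complex_of_real (norm z powi (2 - int D)))"
    by (elim landau_o.bigE)
  then obtain M where M: "\<And>z. norm z \<ge> M \<Longrightarrow> z \<in> sibuya_sector D rho psi k \<Longrightarrow>
      norm (F z - 1) \<le> C * norm (complex_of_real (norm z powi (2 - int D)))"
    unfolding eventually_inf_principal eventually_at_infinity by blast
  obtain R0 where R0: "\<And>t. t \<ge> R0 \<Longrightarrow> cball (complex_of_real t * \<omega>) 1 \<subseteq> sibuya_sector D rho psi k"
    using disc_subset_sibuya_sector[OF rc D(1)] D(2) unfolding \<omega>_def by fastforce
  have near: "norm (F z - 1) \<le> C / norm z" if "norm z \<ge> M" "norm z \<ge> 1" "z \<in> sibuya_sector D rho psi k" for z
  proof -
    have "norm z powi (2 - int D) \<le> norm z powi (-1)"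
      using that D by (intro power_int_increasing) auto
    then have "C * norm z powi (2 - int D) \<le> C * norm z powi (-1)"
      using C by (intro mult_left_mono) auto
    then show ?thesis using M[OF that(1,3)] by (simp add: power_int_minus divide_inverse norm_power_int)
  qed
  define R where "R = max (max R0 2) (M + 1)"
  have disc: "norm (F z - 1) \<le> C / (t - 1)" if t: "t \<ge> R" and z: "z \<in> cball (complex_of_real t * \<omega>) 1" for t z
  proof -
    have t2: "t \<ge> 2" "t \<ge> M + 1" "t \<ge> R0" using t by (auto simp: R_def)
    have "t \<le> norm z + 1"
      using norm_triangle_ineq2[of "complex_of_real t * \<omega>" z] z t2 n\<omega> by (simp add: norm_mult dist_norm)
    then have "norm (F z - 1) \<le> C / norm z" using t2 R0[OF t2(3)] z by (intro near) auto
    also have "\<dots> \<le> C / (t - 1)" using \<open>t \<le> norm z + 1\<close> t2 C by (intro divide_left_mono mult_pos_pos) auto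
    finally show ?thesis .
  qed
  show lim: "((\<lambda>t. F (complex_of_real t * cis (pi * real k / real D))) \<longlongrightarrow> 1) at_top"
    unfolding \<omega>_def[symmetric]
  proof (rule LIM_zero_cancel, rule Lim_null_comparison)
    show "\<forall>\<^sub>F t in at_top. norm (F (complex_of_real t * \<omega>) - 1) \<le> C / (t - 1)"
      using eventually_ge_at_top[of R] by eventually_elim (rule disc, auto)
    show "((\<lambda>t. C / (t - 1)) \<longlongrightarrow> 0) at_top"
    proof (rule real_tendsto_divide_at_top[OF tendsto_const])
      show "filterlim (\<lambda>t::real. t - 1) at_top at_top"
        using filterlim_tendsto_add_at_top[OF tendsto_const[of "-1::real"] filterlim_ident] by simp
    qed
  qed
  define f where "f = (\<lambda>t. norm (F (complex_of_real t * \<omega>)) + norm (deriv F (complex_of_real t * \<omega>)))"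
  have tail: "f t \<le> (1 + C) + (1 + C)" if t: "t \<ge> R" for t
  proof -
    have t2: "t \<ge> 2" using t by (auto simp: R_def)
    have bd: "norm (F z) \<le> 1 + C" if "z \<in> cball (complex_of_real t * \<omega>) 1" for z
    proof -
      have "C / (t - 1) \<le> C" using t2 C by (simp add: field_simps)
      then show ?thesis using disc[OF t that] norm_triangle_ineq[of 1 "F z - 1"] by simp
    qed
    have "norm ((deriv ^^ 1) F (complex_of_real t * \<omega>)) \<le> fact 1 * (1 + C) / 1 ^ 1"
    proof (rule Cauchy_inequality)
      show "F holomorphic_on ball (complex_of_real t * \<omega>) 1" using hol by (rule holomorphic_on_subset) auto
      show "continuous_on (cball (complex_of_real t * \<omega>) 1) F"
        using hol by (intro holomorphic_on_imp_continuous_on) (rule holomorphic_on_subset, auto)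
      show "norm (F x) \<le> 1 + C" if "norm (complex_of_real t * \<omega> - x) = 1" for x
        using that by (intro bd) (simp add: dist_norm)
    qed auto
    then have "norm (deriv F (complex_of_real t * \<omega>)) \<le> 1 + C" by simp
    moreover have "norm (F (complex_of_real t * \<omega>)) \<le> 1 + C" by (intro bd) simp
    ultimately show ?thesis unfolding f_def by (rule add_mono[rotated])
  qed
  have holcont: "continuous_on UNIV F" "continuous_on UNIV (deriv F)"
    using hol holomorphic_deriv[OF hol open_UNIV] by (auto intro: holomorphic_on_imp_continuous_on)
  have "continuous_on {0..R} f"
    unfolding f_def by (intro continuous_intros continuous_on_compose2[OF holcont(1)] continuous_on_compose2[OF holcont(2)]) auto
  then have "bounded (f ` {0..R})" by (intro compact_imp_bounded compact_continuous_image) auto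
  then obtain B where B: "\<And>t. t \<in> {0..R} \<Longrightarrow> norm (f t) \<le> B" unfolding bounded_iff by blast
  have "norm (F (complex_of_real t * \<omega>)) \<le> max B (2 + 2 * C) \<and> norm (deriv F (complex_of_real t * \<omega>)) \<le> max B (2 + 2 * C)"
    if t: "t \<ge> 0" for t
  proof -
    have "f t \<le> max B (2 + 2 * C)" using B[of t] tail[of t] t by (cases "t \<le> R") auto
    then show ?thesis using norm_ge_zero[of "F (complex_of_real t * \<omega>)"] norm_ge_zero[of "deriv F (complex_of_real t * \<omega>)"]
      unfolding f_def by linarith
  qed
  then show "\<exists>B. \<forall>t\<ge>0. norm (F (complex_of_real t * cis (pi * real k / real D))) \<le> B
               \<and> norm (deriv F (complex_of_real t * cis (pi * real k / real D))) \<le> B"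
    unfolding \<omega>_def by blast
qed

section \<open>Integration by parts\<close>

text \<open>
  The operator \<open>L\<close> that turns the Sobolev product into the weighted \<open>L\<^sup>2\<close> product.
\<close>
definition sobolev_op :: "'a::idom poly \<Rightarrow> 'a \<Rightarrow> 'a poly \<Rightarrow> 'a poly" where
  "sobolev_op V lam Q = Q + smult lam (pderiv V * pderiv Q - pderiv (pderiv Q))"

lemma cpoly_add: "cpoly (p + q) = cpoly p + cpoly q"
  by (simp add: poly_eq_iff)

lemma cpoly_diff: "cpoly (p - q) = cpoly p - cpoly q"
  by (simp add: poly_eq_iff)

lemma cpoly_smult: "cpoly (smult c p) = smult (complex_of_real c) (cpoly p)"
  by (simp add: poly_eq_iff)

lemma cpoly_mult: "cpoly (p * q) = cpoly p * cpoly q"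
  by (simp add: poly_eq_iff coeff_mult)

lemma cpoly_pderiv: "cpoly (pderiv p) = pderiv (cpoly p)"
  by (simp add: poly_eq_iff coeff_pderiv)

lemma cpoly_sobolev_op: "cpoly (sobolev_op V lam q) = sobolev_op (cpoly V) (complex_of_real lam) (cpoly q)"
  by (simp add: sobolev_op_def cpoly_add cpoly_diff cpoly_smult cpoly_mult cpoly_pderiv)

lemma half_line_FTC:
  fixes G g :: "real \<Rightarrow> complex"
  assumes G: "\<And>t. (G has_vector_derivative g t) (at t)"
    and cont: "continuous_on UNIV g" and bd: "\<And>t. t \<ge> 0 \<Longrightarrow> norm (g t) \<le> C * exp (- t)"
    and lim: "(G \<longlongrightarrow> 0) at_top"
  shows "(LBINT t:{0..}. g t) = - G 0"
proof -
  have int: "set_integrable lborel {0..} g"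
    by (rule set_integrable_exp_decay[OF continuous_on_subset[OF cont] bd]) auto
  have "(LBINT t:{0..}. g t) = (LBINT t:{0<..}. g t)"
    unfolding set_lebesgue_integral_def
  proof (rule integral_cong_AE)
    show "AE t in lborel. indicator {0..} t *\<^sub>R g t = indicator {0<..} t *\<^sub>R g t"
      using AE_lborel_singleton[of 0] by eventually_elim (auto simp: indicator_def)
    show "(\<lambda>t. indicator {0..} t *\<^sub>R g t) \<in> borel_measurable lborel"
      using borel_measurable_continuous_on_indicator[of "{0..}" g] continuous_on_subset[OF cont] by simp
    show "(\<lambda>t. indicator {0<..} t *\<^sub>R g t) \<in> borel_measurable lborel"
      using borel_measurable_continuous_on_indicator[of "{0<..}" g] continuous_on_subset[OF cont] by simp
  qed
  also have "\<dots> = (LBINT t=ereal 0..\<infinity>. g t)" by (simp only: interval_integral_to_infinity_eq)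
  also have "\<dots> = 0 - G 0"
  proof (rule interval_integral_FTC_integrable)
    show "isCont g x" for x using cont by (simp add: continuous_on_eq_continuous_at)
    show "set_integrable lborel (einterval (ereal 0) \<infinity>) g"
      by (rule set_integrable_subset[OF int]) (auto simp: einterval_def)
    show "((G \<circ> real_of_ereal) \<longlongrightarrow> G 0) (at_right (ereal 0))"
      unfolding ereal_tendsto_simps
      using has_vector_derivative_continuous[OF G, of 0]
      by (metis continuous_at_imp_continuous_at_within continuous_within)
    show "((G \<circ> real_of_ereal) \<longlongrightarrow> 0) (at_left \<infinity>)"
      unfolding ereal_tendsto_simps by (rule lim)
  qed (use G in auto)
  finally show ?thesis by simp
qed

text \<open>
  The function \<open>A\<close> in the proof is a primitive of the integrand by the differential equation; it vanishes at
  infinity on the ray, and its value at \<open>0\<close> remains.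
\<close>
lemma ray_integral_sobolev_op:
  fixes V :: "real poly" and Q :: "complex poly" and lam :: real and k D :: nat
  defines "\<omega> \<equiv> cis (pi * real k / real D)"
  assumes V: "degree V = D" "D \<ge> 2" "lead_coeff V > 0" and \<omega>D: "\<omega> ^ D = 1" and lam: "lam \<noteq> 0"
    and hol: "F holomorphic_on UNIV"
    and ode: "\<And>z. poly (cpoly (pderiv V)) z * deriv F z - deriv (deriv F) z + F z / complex_of_real lam = 0"
    and bdd: "\<And>t. t \<ge> 0 \<Longrightarrow> norm (F (complex_of_real t * \<omega>)) \<le> B \<and> norm (deriv F (complex_of_real t * \<omega>)) \<le> B"
  shows "ray_integral D k (\<lambda>z. exp (- poly (cpoly V) z) * F z * poly (sobolev_op (cpoly V) (complex_of_real lam) Q) z)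
       = complex_of_real lam * exp (- poly (cpoly V) 0) * (F 0 * poly (pderiv Q) 0 - deriv F 0 * poly Q 0)"
proof -
  define A where "A = (\<lambda>z. complex_of_real lam * exp (- poly (cpoly V) z) * (deriv F z * poly Q z - F z * poly (pderiv Q) z))"
  define a where "a = (\<lambda>z. exp (- poly (cpoly V) z) * F z * poly (sobolev_op (cpoly V) (complex_of_real lam) Q) z)"
  have n\<omega>: "norm \<omega> = 1" by (simp add: \<omega>_def)
  have B0: "B \<ge> 0" using order_trans[OF norm_ge_zero conjunct1[OF bdd[of 0]]] by simp
  have dF: "(F has_field_derivative deriv F z) (at z)" for z
    using hol by (intro holomorphic_derivI[of F UNIV]) auto
  have dF': "(deriv F has_field_derivative deriv (deriv F) z) (at z)" for z
    using holomorphic_deriv[OF hol open_UNIV] by (intro holomorphic_derivI[of "deriv F" UNIV]) auto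
  have ode': "deriv (deriv F) z = poly (cpoly (pderiv V)) z * deriv F z + F z / complex_of_real lam" for z
    using ode[of z] by (simp add: algebra_simps)
  have dA: "(A has_field_derivative a z) (at z)" for z
    unfolding A_def a_def
    using lam by (auto intro!: derivative_eq_intros dF dF' simp: ode' sobolev_op_def cpoly_pderiv field_simps)
  have hA: "A holomorphic_on UNIV" "a holomorphic_on UNIV"
    unfolding A_def a_def by (intro holomorphic_intros hol holomorphic_deriv[OF hol] | simp)+
  obtain C1 where C1: "\<And>t. t \<ge> 0 \<Longrightarrow> norm (exp (- poly (cpoly V) (complex_of_real t * \<omega>)))
           * norm (poly (sobolev_op (cpoly V) (complex_of_real lam) Q) (complex_of_real t * \<omega>)) \<le> C1 * exp (- t)"
    using weight_times_poly_decay_on_ray[OF V n\<omega> \<omega>D] by blast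
  obtain C2 where C2: "\<And>t. t \<ge> 0 \<Longrightarrow> norm (exp (- poly (cpoly V) (complex_of_real t * \<omega>)))
           * norm (poly Q (complex_of_real t * \<omega>)) \<le> C2 * exp (- t)"
    using weight_times_poly_decay_on_ray[OF V n\<omega> \<omega>D] by blast
  obtain C3 where C3: "\<And>t. t \<ge> 0 \<Longrightarrow> norm (exp (- poly (cpoly V) (complex_of_real t * \<omega>)))
           * norm (poly (pderiv Q) (complex_of_real t * \<omega>)) \<le> C3 * exp (- t)"
    using weight_times_poly_decay_on_ray[OF V n\<omega> \<omega>D] by blast
  have "(LBINT t:{0..}. a (complex_of_real t * \<omega>) * \<omega>) = - A (complex_of_real 0 * \<omega>)"
  proof (rule half_line_FTC)
    fix t :: real
    have "((\<lambda>t. complex_of_real t * \<omega>) has_vector_derivative \<omega>) (at t)"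
      by (auto intro!: derivative_eq_intros)
    from field_vector_diff_chain_at[OF this dA]
    show "((\<lambda>t. A (complex_of_real t * \<omega>)) has_vector_derivative a (complex_of_real t * \<omega>) * \<omega>) (at t)"
      by (simp add: o_def mult.commute)
    show "norm (a (complex_of_real t * \<omega>) * \<omega>) \<le> (B * C1) * exp (- t)" if "t \<ge> 0"
      using mult_mono[OF conjunct1[OF bdd[OF that]] C1[OF that]] B0 n\<omega>
      by (simp add: a_def norm_mult mult_ac)
  next
    show "continuous_on UNIV (\<lambda>t. a (complex_of_real t * \<omega>) * \<omega>)"
      by (intro continuous_intros continuous_on_compose2[OF holomorphic_on_imp_continuous_on[OF hA(2)]]) auto
    show "((\<lambda>t. A (complex_of_real t * \<omega>)) \<longlongrightarrow> 0) at_top"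
    proof (rule Lim_null_comparison)
      show "\<forall>\<^sub>F t in at_top. norm (A (complex_of_real t * \<omega>)) \<le> \<bar>lam\<bar> * (B * C2 + B * C3) * exp (- t)"
        using eventually_ge_at_top[of 0]
      proof eventually_elim
        case (elim t)
        let ?z = "complex_of_real t * \<omega>"
        have "norm (A ?z) \<le> \<bar>lam\<bar> * norm (exp (- poly (cpoly V) ?z)) * (norm (deriv F ?z) * norm (poly Q ?z) + norm (F ?z) * norm (poly (pderiv Q) ?z))"
          unfolding A_def norm_mult
          by (intro mult_mono order_trans[OF norm_triangle_ineq4]) (auto simp: norm_mult)
        also have "\<dots> = \<bar>lam\<bar> * (norm (deriv F ?z) * (norm (exp (- poly (cpoly V) ?z)) * norm (poly Q ?z))
             + norm (F ?z) * (norm (exp (- poly (cpoly V) ?z)) * norm (poly (pderiv Q) ?z)))" by (simp add: algebra_simps)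
        also have "\<dots> \<le> \<bar>lam\<bar> * (B * (C2 * exp (- t)) + B * (C3 * exp (- t)))"
          by (intro mult_left_mono add_mono mult_mono[OF conjunct2[OF bdd[OF elim]] C2[OF elim] B0]
                mult_mono[OF conjunct1[OF bdd[OF elim]] C3[OF elim] B0]) auto
        finally show ?case by (simp add: algebra_simps)
      qed
      have "((\<lambda>s::real. exp (- s)) \<longlongrightarrow> 0) at_top"
        by (rule filterlim_compose[OF exp_at_bot filterlim_uminus_at_bot_at_top])
      then show "((\<lambda>t. \<bar>lam\<bar> * (B * C2 + B * C3) * exp (- t)) \<longlongrightarrow> 0) at_top"
        by (rule tendsto_mult_right_zero)
    qed
  qed
  then show ?thesis by (simp add: ray_integral_def a_def A_def \<omega>_def algebra_simps)
qed

section \<open>The Wronskian of the two real solutions\<close>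

text \<open>
  Along the half-line in direction \<open>\<sigma>\<close> the function \<open>H t = \<sigma> exp (- V) Re (F' cnj F)\<close> has derivative
  \<open>exp (- V) (\<bar>F'\<bar>\<^sup>2 + \<bar>F\<bar>\<^sup>2 / \<lambda>) \<ge> 0\<close>, which is positive far out, and it tends to \<open>0\<close>. So it is negative at \<open>0\<close>.
  Applied with \<open>\<sigma> = 1\<close> and \<open>\<sigma> = -1\<close> this separates the logarithmic derivatives at \<open>0\<close> of the two solutions that
  are bounded on the two halves of the real line.
\<close>
lemma deriv_times_cnj_negative:
  fixes V :: "real poly" and \<sigma> lam :: real
  assumes V: "degree V = D" "D \<ge> 2" "lead_coeff V > 0" and \<sigma>: "\<bar>\<sigma>\<bar> = 1" "\<sigma> ^ D = 1" and lam: "lam > 0"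
    and hol: "F holomorphic_on UNIV"
    and ode: "\<And>z. poly (cpoly (pderiv V)) z * deriv F z - deriv (deriv F) z + F z / complex_of_real lam = 0"
    and bdd: "\<And>t. t \<ge> 0 \<Longrightarrow> norm (F (complex_of_real (t * \<sigma>))) \<le> B \<and> norm (deriv F (complex_of_real (t * \<sigma>))) \<le> B"
    and lim: "((\<lambda>t. F (complex_of_real (t * \<sigma>))) \<longlongrightarrow> 1) at_top"
  shows "\<sigma> * Re (deriv F 0 * cnj (F 0)) < 0"
proof -
  define H where "H = (\<lambda>t. exp (- poly V (t * \<sigma>)) * (\<sigma> * Re (deriv F (complex_of_real (t * \<sigma>)) * cnj (F (complex_of_real (t * \<sigma>))))))"
  define h where "h = (\<lambda>t. exp (- poly V (t * \<sigma>)) *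
     (norm (deriv F (complex_of_real (t * \<sigma>))) ^ 2 + norm (F (complex_of_real (t * \<sigma>))) ^ 2 / lam))"
  have B0: "B \<ge> 0" using order_trans[OF norm_ge_zero conjunct1[OF bdd[of 0]]] by simp
  have \<sigma>2: "\<sigma> * \<sigma> = 1" using \<sigma>(1) by (metis abs_mult_self_eq mult_1)
  have dF: "(F has_field_derivative deriv F z) (at z)" for z
    using hol by (intro holomorphic_derivI[of F UNIV]) auto
  have dF': "(deriv F has_field_derivative deriv (deriv F) z) (at z)" for z
    using holomorphic_deriv[OF hol open_UNIV] by (intro holomorphic_derivI[of "deriv F" UNIV]) auto
  have ode': "deriv (deriv F) z = poly (cpoly (pderiv V)) z * deriv F z + F z / complex_of_real lam" for z
    using ode[of z] by (simp add: algebra_simps)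
  have dH: "(H has_real_derivative h t) (at t)" for t
  proof -
    let ?x = "complex_of_real (t * \<sigma>)"
    have d0: "((\<lambda>t. complex_of_real (t * \<sigma>)) has_vector_derivative complex_of_real \<sigma>) (at t)"
      by (auto intro!: derivative_eq_intros)
    have d1: "((\<lambda>t. F (complex_of_real (t * \<sigma>))) has_vector_derivative complex_of_real \<sigma> * deriv F ?x) (at t)"
      using field_vector_diff_chain_at[OF d0 dF] by (simp add: o_def)
    have d2: "((\<lambda>t. deriv F (complex_of_real (t * \<sigma>))) has_vector_derivative complex_of_real \<sigma> * deriv (deriv F) ?x) (at t)"
      using field_vector_diff_chain_at[OF d0 dF'] by (simp add: o_def)
    have d3: "((\<lambda>t. deriv F (complex_of_real (t * \<sigma>)) * cnj (F (complex_of_real (t * \<sigma>)))) has_vector_derivative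
        deriv F ?x * cnj (complex_of_real \<sigma> * deriv F ?x) + complex_of_real \<sigma> * deriv (deriv F) ?x * cnj (F ?x)) (at t)"
      by (rule has_vector_derivative_mult[OF d2 has_vector_derivative_cnj[OF d1]])
    have d4: "((\<lambda>t. Re (deriv F (complex_of_real (t * \<sigma>)) * cnj (F (complex_of_real (t * \<sigma>))))) has_real_derivative
        Re (deriv F ?x * cnj (complex_of_real \<sigma> * deriv F ?x) + complex_of_real \<sigma> * deriv (deriv F) ?x * cnj (F ?x))) (at t)"
      using bounded_linear.has_vector_derivative[OF bounded_linear_Re d3] by (simp only: has_real_derivative_iff_has_vector_derivative)
    have re: "Re (deriv F ?x * cnj (complex_of_real \<sigma> * deriv F ?x) + complex_of_real \<sigma> * deriv (deriv F) ?x * cnj (F ?x))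
        = \<sigma> * (norm (deriv F ?x) ^ 2 + norm (F ?x) ^ 2 / lam + poly (pderiv V) (t * \<sigma>) * Re (deriv F ?x * cnj (F ?x)))"
    proof -
      have "deriv (deriv F) ?x * cnj (F ?x) = complex_of_real (poly (pderiv V) (t * \<sigma>)) * (deriv F ?x * cnj (F ?x))
           + complex_of_real (norm (F ?x) ^ 2 / lam)"
        unfolding ode' poly_cpoly_of_real of_real_divide complex_norm_square by (simp add: algebra_simps)
      moreover have "deriv F ?x * cnj (complex_of_real \<sigma> * deriv F ?x) = complex_of_real (\<sigma> * norm (deriv F ?x) ^ 2)"
        unfolding of_real_mult complex_norm_square by simp
      ultimately show ?thesis
        by (simp only: mult.assoc) (simp add: algebra_simps)
    qed
    have d5: "((\<lambda>t. exp (- poly V (t * \<sigma>))) has_real_derivative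
        exp (- poly V (t * \<sigma>)) * (- (poly (pderiv V) (t * \<sigma>) * \<sigma>))) (at t)"
      by (auto intro!: derivative_eq_intros DERIV_chain2[OF poly_DERIV])
    have "(H has_real_derivative
        exp (- poly V (t * \<sigma>)) * (- (poly (pderiv V) (t * \<sigma>) * \<sigma>)) * (\<sigma> * Re (deriv F ?x * cnj (F ?x)))
        + \<sigma> * (\<sigma> * (norm (deriv F ?x) ^ 2 + norm (F ?x) ^ 2 / lam + poly (pderiv V) (t * \<sigma>) * Re (deriv F ?x * cnj (F ?x)))) * exp (- poly V (t * \<sigma>))) (at t)"
      unfolding H_def re[symmetric] by (rule DERIV_mult[OF d5 DERIV_cmult[OF d4]])
    also have "exp (- poly V (t * \<sigma>)) * (- (poly (pderiv V) (t * \<sigma>) * \<sigma>)) * (\<sigma> * Re (deriv F ?x * cnj (F ?x)))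
        + \<sigma> * (\<sigma> * (norm (deriv F ?x) ^ 2 + norm (F ?x) ^ 2 / lam + poly (pderiv V) (t * \<sigma>) * Re (deriv F ?x * cnj (F ?x)))) * exp (- poly V (t * \<sigma>))
        = (\<sigma> * \<sigma>) * h t"
      unfolding h_def by (simp only: algebra_simps minus_mult_left[symmetric] minus_mult_right[symmetric])
    finally show ?thesis using \<sigma>2 by simp
  qed
  have h_nonneg: "h t \<ge> 0" for t using lam by (simp add: h_def)
  have mono: "H s \<le> H t" if "s \<le> t" for s t
    using DERIV_nonneg_imp_nondecreasing[OF that] dH h_nonneg by blast
  have H0: "(H \<longlongrightarrow> 0) at_top"
  proof -
    have "norm (complex_of_real \<sigma>) = 1" "complex_of_real \<sigma> ^ D = 1"
      using \<sigma> by (simp_all flip: of_real_power)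
    then obtain C where C: "C \<ge> 0" "\<And>t. t \<ge> 0 \<Longrightarrow> norm (exp (- poly (cpoly V) (complex_of_real t * complex_of_real \<sigma>))) * exp (poly 0 t) \<le> C * exp (- t)"
      using weight_decay_on_ray[OF V, of "complex_of_real \<sigma>" 0] V by auto
    show ?thesis
    proof (rule Lim_null_comparison)
      show "\<forall>\<^sub>F t in at_top. norm (H t) \<le> (C * (B * B)) * exp (- t)"
        using eventually_ge_at_top[of 0]
      proof eventually_elim
        case (elim t)
        let ?x = "complex_of_real (t * \<sigma>)"
        have w: "exp (- poly V (t * \<sigma>)) \<le> C * exp (- t)"
          using C(2)[OF elim] by (simp flip: of_real_mult add: norm_exp_eq_Re)
        have "\<bar>Re (deriv F ?x * cnj (F ?x))\<bar> \<le> norm (deriv F ?x) * norm (F ?x)"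
          using abs_Re_le_cmod[of "deriv F ?x * cnj (F ?x)"] by (simp add: norm_mult)
        also have "\<dots> \<le> B * B" using bdd[OF elim] B0 by (intro mult_mono) auto
        finally have "norm (H t) \<le> (C * exp (- t)) * (1 * (B * B))"
          unfolding H_def norm_mult using w \<sigma> B0 C by (intro mult_mono) auto
        then show ?case by (simp add: mult_ac)
      qed
      have "((\<lambda>s::real. exp (- s)) \<longlongrightarrow> 0) at_top"
        by (rule filterlim_compose[OF exp_at_bot filterlim_uminus_at_bot_at_top])
      then show "((\<lambda>t. (C * (B * B)) * exp (- t)) \<longlongrightarrow> 0) at_top"
        by (rule tendsto_mult_right_zero)
    qed
  qed
  have H_le: "H t \<le> 0" for t
    by (rule tendsto_lowerbound[OF H0]) (auto intro: eventually_mono[OF eventually_ge_at_top[of t]] mono)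
  obtain t0 where t0: "\<And>t. t \<ge> t0 \<Longrightarrow> norm (F (complex_of_real (t * \<sigma>)) - 1) < 1"
    using tendstoD[OF lim, of 1] by (auto simp: eventually_at_top_linorder dist_norm)
  define T where "T = max t0 0"
  have h_pos: "h t > 0" if "t \<ge> T" for t
  proof -
    have "F (complex_of_real (t * \<sigma>)) \<noteq> 0" using t0[of t] that by (auto simp: T_def)
    then show ?thesis unfolding h_def using lam
      by (intro mult_pos_pos add_nonneg_pos divide_pos_pos) auto
  qed
  have "H T < H (T + 1)"
    by (rule DERIV_pos_imp_increasing) (use dH h_pos in auto)
  then have "H 0 < 0" using H_le[of "T + 1"] mono[of 0 T] by (simp add: T_def)
  then show ?thesis by (simp add: H_def mult_less_0_iff)
qed

section \<open>The Sobolev inner product\<close>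

text \<open>
  Polynomials \<open>b m\<close> of degree exactly \<open>m\<close> form a basis. The lemma serves for monomials, for orthogonal
  polynomials, and for monomials completed by images under \<open>L\<close>. The condition on \<open>p\<close> is put in terms
  of coefficients, so that \<open>n = 0\<close> forces \<open>p = 0\<close>.
\<close>
lemma linear_functional_vanishes_on_polys:
  fixes \<Lambda> :: "'a::field poly \<Rightarrow> 'a"
  assumes add: "\<And>p q. \<Lambda> (p + q) = \<Lambda> p + \<Lambda> q" and smult: "\<And>c p. \<Lambda> (smult c p) = c * \<Lambda> p"
    and b: "\<And>m. m < n \<Longrightarrow> b m \<noteq> 0 \<and> degree (b m) = m" "\<And>m. m < n \<Longrightarrow> \<Lambda> (b m) = 0"
    and p: "\<And>i. i \<ge> n \<Longrightarrow> coeff p i = 0"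
  shows "\<Lambda> p = 0"
  using b p
proof (induction n arbitrary: p)
  case 0
  then have "p = 0" by (simp add: poly_eq_iff)
  then show ?case using smult[of 0 0] by simp
next
  case (Suc n)
  define c where "c = coeff p n / coeff (b n) n"
  have "b n \<noteq> 0" and deg: "degree (b n) = n" using Suc.prems(1)[of n] by auto
  then have bn: "coeff (b n) n \<noteq> 0" "degree (b n) = n"
    using leading_coeff_neq_0[of "b n"] by (simp_all only: deg not_False_eq_True)
  have "\<Lambda> (p - smult c (b n)) = 0"
  proof (rule Suc.IH)
    fix i assume "n \<le> i"
    then show "coeff (p - smult c (b n)) i = 0"
      using bn Suc.prems(3)[of i] by (cases "i = n") (auto simp: c_def coeff_eq_0)
  qed (use Suc.prems in auto)
  moreover have "\<Lambda> p = \<Lambda> (p - smult c (b n)) + c * \<Lambda> (b n)" by (simp flip: add smult)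
  ultimately show ?case using Suc.prems(2)[of n] by simp
qed

lemma integrable_exp_minus_abs: "integrable lborel (\<lambda>x::real. exp (- \<bar>x\<bar>))"
proof -
  have 1: "set_integrable lborel {0..} (\<lambda>x::real. exp (- \<bar>x\<bar>))"
    by (rule set_integrable_exp_decay[of _ 1]) (auto intro!: continuous_intros)
  have "integrable lborel (\<lambda>x. indicator {0..} (0 + -1 * x) *\<^sub>R exp (- \<bar>0 + -1 * x\<bar>) :: real)"
    using 1 unfolding set_integrable_def by (subst lborel_integrable_real_affine_iff) auto
  then have 2: "set_integrable lborel {..0} (\<lambda>x::real. exp (- \<bar>x\<bar>))"
    unfolding set_integrable_def by (rule back_subst[of "integrable lborel"]) (auto simp: indicator_def fun_eq_iff)
  have "{0..} \<union> {..0} = (UNIV :: real set)" by auto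
  then show ?thesis using set_integrable_Un[OF 1 2] by (simp add: set_integrable_def)
qed

lemma weight_times_poly_decay_on_line:
  fixes V :: "real poly" and p :: "complex poly"
  assumes V: "degree V = D" "D \<ge> 2" "lead_coeff V > 0" "even D"
  shows "\<exists>C. \<forall>x::real. norm (poly p (complex_of_real x) * complex_of_real (exp (- poly V x))) \<le> C * exp (- \<bar>x\<bar>)"
proof -
  obtain C1 where C1: "C1 \<ge> 0" "\<And>t. t \<ge> 0 \<Longrightarrow> norm (exp (- poly (cpoly V) (complex_of_real t * 1)))
           * norm (poly p (complex_of_real t * 1)) \<le> C1 * exp (- t)"
    using weight_times_poly_decay_on_ray[OF V(1-3), of 1] by auto
  obtain C2 where C2: "C2 \<ge> 0" "\<And>t. t \<ge> 0 \<Longrightarrow> norm (exp (- poly (cpoly V) (complex_of_real t * -1)))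
           * norm (poly p (complex_of_real t * -1)) \<le> C2 * exp (- t)"
    using weight_times_poly_decay_on_ray[OF V(1-3), of "-1"] V(4) by auto
  have exp_eq: "norm (exp (- poly (cpoly V) (complex_of_real x))) = exp (- poly V x)" for x
    by (simp add: norm_exp_eq_Re)
  show ?thesis
  proof (intro exI[of _ "C1 + C2"] allI)
    fix x :: real
    have "norm (poly p (complex_of_real x) * complex_of_real (exp (- poly V x)))
        = norm (exp (- poly (cpoly V) (complex_of_real x))) * norm (poly p (complex_of_real x))"
      unfolding exp_eq by (simp add: norm_mult)
    also have "\<dots> \<le> (C1 + C2) * exp (- \<bar>x\<bar>)"
    proof (cases "x \<ge> 0")
      case True
      then have "norm (exp (- poly (cpoly V) (complex_of_real x))) * norm (poly p (complex_of_real x)) \<le> C1 * exp (- \<bar>x\<bar>)"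
        using C1(2)[of x] by simp
      also have "\<dots> \<le> (C1 + C2) * exp (- \<bar>x\<bar>)" using C2(1) by (intro mult_right_mono) auto
      finally show ?thesis .
    next
      case False
      then have "norm (exp (- poly (cpoly V) (complex_of_real x))) * norm (poly p (complex_of_real x)) \<le> C2 * exp (- \<bar>x\<bar>)"
        using C2(2)[of "- x"] by simp
      also have "\<dots> \<le> (C1 + C2) * exp (- \<bar>x\<bar>)" using C1(1) by (intro mult_right_mono) auto
      finally show ?thesis .
    qed
    finally show "norm (poly p (complex_of_real x) * complex_of_real (exp (- poly V x))) \<le> (C1 + C2) * exp (- \<bar>x\<bar>)" .
  qed
qed

lemma integrable_poly_times_weight:
  fixes V :: "real poly" and p :: "complex poly"
  assumes V: "degree V = D" "D \<ge> 2" "lead_coeff V > 0" "even D"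
  shows "integrable lborel (\<lambda>x. poly p (complex_of_real x) * complex_of_real (exp (- poly V x)))"
proof -
  obtain C where C: "\<And>x::real. norm (poly p (complex_of_real x) * complex_of_real (exp (- poly V x))) \<le> C * exp (- \<bar>x\<bar>)"
    using weight_times_poly_decay_on_line[OF V] by blast
  show ?thesis
  proof (rule Bochner_Integration.integrable_bound)
    show "integrable lborel (\<lambda>x. C * exp (- \<bar>x\<bar>))" using integrable_exp_minus_abs by simp
    show "(\<lambda>x. poly p (complex_of_real x) * complex_of_real (exp (- poly V x))) \<in> borel_measurable lborel"
      using borel_measurable_continuous_onI[of "\<lambda>x. poly p (complex_of_real x) * complex_of_real (exp (- poly V x))"]
      by (simp add: continuous_intros)
    show "AE x in lborel. norm (poly p (complex_of_real x) * complex_of_real (exp (- poly V x))) \<le> norm (C * exp (- \<bar>x\<bar>))"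
      by (intro AE_I2 order_trans[OF C]) simp
  qed
qed

lemma integrable_real_poly_times_weight:
  fixes V p :: "real poly"
  assumes V: "degree V = D" "D \<ge> 2" "lead_coeff V > 0" "even D"
  shows "integrable lborel (\<lambda>x. poly p x * exp (- poly V x))"
proof -
  have "integrable lborel (\<lambda>x. complex_of_real (poly p x * exp (- poly V x)))"
    using integrable_poly_times_weight[OF V, of "cpoly p"] by simp
  then show ?thesis by (simp only: complex_of_real_integrable_eq)
qed

lemma weighted_product_integrable:
  fixes V p q :: "real poly"
  assumes V: "degree V = D" "D \<ge> 2" "lead_coeff V > 0" "even D"
  shows "integrable lborel (\<lambda>x. poly p x * poly q x * exp (- poly V x))"
  using integrable_real_poly_times_weight[OF V, of "p * q"] by simp

lemma sobolev_inner_commute: "sobolev_inner V lam p q = sobolev_inner V lam q p"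
  by (simp add: sobolev_inner_def mult.commute)

lemma sobolev_inner_add_left:
  fixes V :: "real poly"
  assumes V: "degree V = D" "D \<ge> 2" "lead_coeff V > 0" "even D"
  shows "sobolev_inner V lam (p + p') q = sobolev_inner V lam p q + sobolev_inner V lam p' q"
  unfolding sobolev_inner_def
  by (simp add: distrib_right distrib_left pderiv_add weighted_product_integrable[OF V])

lemma sobolev_inner_smult_left:
  "sobolev_inner V lam (smult c p) q = c * sobolev_inner V lam p q"
  by (simp add: sobolev_inner_def pderiv_smult distrib_left mult.assoc mult.left_commute[of lam c])

lemma sobolev_inner_add_right:
  fixes V :: "real poly"
  assumes V: "degree V = D" "D \<ge> 2" "lead_coeff V > 0" "even D"
  shows "sobolev_inner V lam p (q + q') = sobolev_inner V lam p q + sobolev_inner V lam p q'"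
  using sobolev_inner_add_left[OF V] by (simp add: sobolev_inner_commute[of V lam p])

lemma sobolev_inner_smult_right:
  "sobolev_inner V lam p (smult c q) = c * sobolev_inner V lam p q"
  using sobolev_inner_smult_left[of V lam c q p] by (simp add: sobolev_inner_commute[of V lam p])

lemma sobolev_inner_definite:
  fixes V :: "real poly"
  assumes V: "degree V = D" "D \<ge> 2" "lead_coeff V > 0" "even D" and lam: "lam > 0"
    and 0: "sobolev_inner V lam p p = 0"
  shows "p = 0"
proof (rule ccontr)
  assume "p \<noteq> 0"
  have nonneg: "(LBINT x. poly q x * poly q x * exp (- poly V x)) \<ge> 0" for q
    by (intro integral_nonneg_AE AE_I2) auto
  have "(LBINT x. poly p x * poly p x * exp (- poly V x)) = 0"
    using 0 nonneg[of p] mult_nonneg_nonneg[OF less_imp_le[OF lam] nonneg[of "pderiv p"]]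
    unfolding sobolev_inner_def by linarith
  then have "AE x in lborel. poly p x * poly p x * exp (- poly V x) = 0"
    by (subst (asm) integral_nonneg_eq_0_iff_AE[OF weighted_product_integrable[OF V]]) auto
  moreover have "AE x in lborel. x \<notin> {x. poly p x = 0}"
    using poly_roots_finite[OF \<open>p \<noteq> 0\<close>] by (intro AE_not_in finite_imp_null_set_lborel)
  ultimately have "AE x::real in lborel. False" by eventually_elim auto
  then show False by (simp add: eventually_False ae_filter_eq_bot_iff)
qed

lemma sobolev_inner_eq_integral_sobolev_op:
  fixes V p q :: "real poly"
  assumes V: "degree V = D" "D \<ge> 2" "lead_coeff V > 0" "even D"
  shows "(LBINT x. poly p x * poly (sobolev_op V lam q) x * exp (- poly V x)) = sobolev_inner V lam p q"
proof -
  let ?w = "\<lambda>x. exp (- poly V x)"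
  define G where "G = (\<lambda>x. poly (p * pderiv q) x * ?w x)"
  define r where "r = pderiv p * pderiv q + p * pderiv (pderiv q) - pderiv V * (p * pderiv q)"
  have dG: "(G has_real_derivative poly r x * ?w x) (at x)" for x
    unfolding G_def r_def by (auto intro!: derivative_eq_intros poly_DERIV simp: pderiv_mult algebra_simps)
  have lim: "(G \<longlongrightarrow> 0) at_top" "(G \<longlongrightarrow> 0) at_bot"
  proof -
    obtain C where C: "\<And>x::real. norm (poly (cpoly (p * pderiv q)) (complex_of_real x) * complex_of_real (?w x)) \<le> C * exp (- \<bar>x\<bar>)"
      using weight_times_poly_decay_on_line[OF V] by blast
    have bd: "norm (G x) \<le> C * exp (- \<bar>x\<bar>)" for x
      using C[of x] unfolding poly_cpoly_of_real G_def of_real_mult[symmetric] norm_of_real by simp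
    have 1: "((\<lambda>x::real. C * exp (- x)) \<longlongrightarrow> 0) at_top" and 2: "((\<lambda>x::real. C * exp x) \<longlongrightarrow> 0) at_bot"
      by (auto intro!: tendsto_mult_right_zero filterlim_compose[OF exp_at_bot filterlim_uminus_at_bot_at_top] exp_at_bot)
    show "(G \<longlongrightarrow> 0) at_top"
    proof (rule Lim_null_comparison[OF _ 1])
      show "\<forall>\<^sub>F x in at_top. norm (G x) \<le> C * exp (- x)"
        using eventually_ge_at_top[of 0] by eventually_elim (metis bd abs_of_nonneg)
    qed
    show "(G \<longlongrightarrow> 0) at_bot"
    proof (rule Lim_null_comparison[OF _ 2])
      show "\<forall>\<^sub>F x in at_bot. norm (G x) \<le> C * exp x"
        using eventually_le_at_bot[of 0] by eventually_elim (metis bd abs_of_nonpos minus_minus)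
    qed
  qed
  have "(LBINT x=-\<infinity>..\<infinity>. poly r x * ?w x) = 0 - 0"
  proof (rule interval_integral_FTC_integrable)
    show "(G has_vector_derivative poly r x * ?w x) (at x)" for x
      using dG by (simp add: has_real_derivative_iff_has_vector_derivative)
    show "set_integrable lborel (einterval (-\<infinity>) \<infinity>) (\<lambda>x. poly r x * ?w x)"
      using integrable_real_poly_times_weight[OF V] by (simp add: set_integrable_def)
    show "((G \<circ> real_of_ereal) \<longlongrightarrow> 0) (at_right (-\<infinity>))" "((G \<circ> real_of_ereal) \<longlongrightarrow> 0) (at_left \<infinity>)"
      unfolding ereal_tendsto_simps by (rule lim)+
  qed (auto intro!: continuous_intros)
  then have r0: "(LBINT x. poly r x * ?w x) = 0"
    by (simp add: interval_lebesgue_integral_def set_lebesgue_integral_def)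
  have "(LBINT x. poly p x * poly (sobolev_op V lam q) x * ?w x)
      = (LBINT x. (poly p x * poly q x * ?w x + lam * (poly (pderiv p) x * poly (pderiv q) x * ?w x)) - lam * (poly r x * ?w x))"
    by (intro Bochner_Integration.integral_cong) (auto simp: sobolev_op_def r_def algebra_simps)
  also have "\<dots> = sobolev_inner V lam p q - lam * (LBINT x. poly r x * ?w x)"
    using weighted_product_integrable[OF V] integrable_real_poly_times_weight[OF V, of r]
    by (simp add: sobolev_inner_def)
  finally show ?thesis using r0 by simp
qed

lemma sobolev_inner_orthogonal_to_basis:
  fixes V :: "real poly"
  assumes V: "degree V = D" "D \<ge> 2" "lead_coeff V > 0" "even D"
    and b: "\<And>m. m < n \<Longrightarrow> b m \<noteq> 0 \<and> degree (b m) = m" "\<And>m. m < n \<Longrightarrow> sobolev_inner V lam p (b m) = 0"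
    and q: "degree q < n"
  shows "sobolev_inner V lam p q = 0"
  by (rule linear_functional_vanishes_on_polys[where b = b and n = n])
    (use b q in \<open>auto simp: sobolev_inner_add_right[OF V] sobolev_inner_smult_right coeff_eq_0\<close>)

lemma monic_sobolev_orthogonal_unique:
  fixes V :: "real poly"
  assumes V: "degree V = D" "D \<ge> 2" "lead_coeff V > 0" "even D" and lam: "lam > 0"
    and p: "degree p = n" "lead_coeff p = 1" "\<And>q. degree q < n \<Longrightarrow> sobolev_inner V lam p q = 0"
    and p': "degree p' = n" "lead_coeff p' = 1" "\<And>q. degree q < n \<Longrightarrow> sobolev_inner V lam p' q = 0"
  shows "p = p'"
proof (cases "n = 0")
  case True
  show ?thesis
  proof (rule poly_eqI)
    show "coeff p i = coeff p' i" for i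
      using p p' True by (cases "i = 0") (auto simp: coeff_eq_0)
  qed
next
  case False
  define r where "r = p + smult (-1) p'"
  have "coeff r i = 0" if "i \<ge> n" for i
    using p p' that by (cases "i = n") (auto simp: r_def coeff_eq_0)
  then have "degree r < n" using False by (metis leading_coeff_0_iff degree_0 not_le gr0I)
  then have "sobolev_inner V lam r r = 0"
    using p(3)[of r] p'(3)[of r]
    unfolding r_def by (subst sobolev_inner_add_left[OF V]) (simp add: sobolev_inner_smult_left[of _ _ "-1", simplified])
  then have "r = 0" by (rule sobolev_inner_definite[OF V lam])
  then show ?thesis by (simp add: r_def)
qed

text \<open>
  The lower coefficients solve a square linear system given by the Gram matrix of the monomials, which is
  injective because the product is definite.
\<close>
lemma ex_monic_sobolev_orthogonal:
  fixes V :: "real poly"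
  assumes V: "degree V = D" "D \<ge> 2" "lead_coeff V > 0" "even D" and lam: "lam > 0"
  shows "\<exists>p. degree p = n \<and> lead_coeff p = 1 \<and> (\<forall>q. degree q < n \<longrightarrow> sobolev_inner V lam p q = 0)"
proof -
  define P where "P = (\<lambda>x. \<Sum>i<n. monom (x i) i :: real poly)"
  have coeff_P: "coeff (P x) k = (if k < n then x k else 0)" for x k
    by (simp add: P_def coeff_sum sum.delta')
  have inner_P: "sobolev_inner V lam (P x) q = (\<Sum>i<n. sobolev_inner V lam (monom 1 i) q * x i)" for x q
  proof -
    have "sobolev_inner V lam (\<Sum>i<m. monom (x i) i) q = (\<Sum>i<m. sobolev_inner V lam (monom 1 i) q * x i)" for m
    proof (induction m)
      case 0
      then show ?case using sobolev_inner_smult_left[of V lam 0 0 q] by simp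
    next
      case (Suc m)
      have "monom (x m) m = smult (x m) (monom 1 m)" by (simp add: smult_monom)
      then show ?case using Suc by (simp add: sobolev_inner_add_left[OF V] sobolev_inner_smult_left)
    qed
    then show ?thesis by (simp add: P_def)
  qed
  have ortho: "sobolev_inner V lam p q = 0"
    if "\<forall>k<n. sobolev_inner V lam p (monom 1 k) = 0" "degree q < n" for p q
    by (rule sobolev_inner_orthogonal_to_basis[OF V, where b = "monom 1" and n = n])
      (use that in \<open>auto simp: degree_monom_eq monom_eq_0_iff\<close>)
  have "\<exists>x. \<forall>k\<in>{..<n}. (\<Sum>i<n. sobolev_inner V lam (monom 1 i) (monom 1 k) * x i) = - sobolev_inner V lam (monom 1 n) (monom 1 k)"
  proof (rule square_system_solvable)
    fix x assume *: "\<forall>k\<in>{..<n}. (\<Sum>i<n. sobolev_inner V lam (monom 1 i) (monom 1 k) * x i) = 0"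
    show "\<forall>i\<in>{..<n}. x i = 0"
    proof (cases "P x = 0")
      case True
      then show ?thesis using coeff_P[of x] by (metis coeff_0 lessThan_iff)
    next
      case False
      then have "coeff (P x) (degree (P x)) \<noteq> 0" by simp
      then have "degree (P x) < n" by (metis coeff_P)
      then have "sobolev_inner V lam (P x) (P x) = 0" using * by (intro ortho) (auto simp: inner_P)
      then show ?thesis using sobolev_inner_definite[OF V lam] False by blast
    qed
  qed auto
  then obtain x where x: "\<And>k. k < n \<Longrightarrow> sobolev_inner V lam (P x) (monom 1 k) = - sobolev_inner V lam (monom 1 n) (monom 1 k)"
    by (auto simp: inner_P)
  define p where "p = monom 1 n + P x"
  have "coeff p n = 1" "\<And>i. i > n \<Longrightarrow> coeff p i = 0" by (auto simp: p_def coeff_P)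
  then have deg: "degree p = n" by (metis degree_le le_antisym le_degree zero_neq_one)
  moreover have "\<forall>q. degree q < n \<longrightarrow> sobolev_inner V lam p q = 0"
    using ortho[of p] x by (auto simp: p_def sobolev_inner_add_left[OF V])
  ultimately show ?thesis using \<open>coeff p n = 1\<close> by auto
qed

text \<open>
  Orthogonality to all earlier members of the sequence is orthogonality to all polynomials of lower
  degree, and this determines each member separately.
\<close>
lemma sobolev_poly_characterization:
  fixes V :: "real poly"
  assumes V: "degree V = D" "D \<ge> 2" "lead_coeff V > 0" "even D" and lam: "lam > 0"
    and p: "degree p = n" "lead_coeff p = 1" "\<And>q. degree q < n \<Longrightarrow> sobolev_inner V lam p q = 0"
  shows "sobolev_poly V lam n = p"
proof -
  have "\<forall>m. \<exists>p. degree p = m \<and> lead_coeff p = 1 \<and> (\<forall>q. degree q < m \<longrightarrow> sobolev_inner V lam p q = 0)"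
    using ex_monic_sobolev_orthogonal[OF V lam] by blast
  then obtain f where f: "\<And>m. degree (f m) = m" "\<And>m. lead_coeff (f m) = 1"
      "\<And>m q. degree q < m \<Longrightarrow> sobolev_inner V lam (f m) q = 0"
    by metis
  have orth: "is_sobolev_orthogonal V lam f"
    unfolding is_sobolev_orthogonal_def
  proof (intro conjI allI impI)
    fix k m :: nat assume "k \<noteq> m"
    then show "sobolev_inner V lam (f k) (f m) = 0"
      using f(3)[of "f m" k] f(3)[of "f k" m] f(1) sobolev_inner_commute[of V lam "f k"]
      by (cases "k < m") auto
  qed (use f in auto)
  have uniq: "g = f" if g: "is_sobolev_orthogonal V lam g" for g
  proof
    fix m
    note g' = g[unfolded is_sobolev_orthogonal_def, THEN conjunct1, THEN spec, THEN conjunct1]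
      g[unfolded is_sobolev_orthogonal_def, THEN conjunct1, THEN spec, THEN conjunct2]
      g[unfolded is_sobolev_orthogonal_def, THEN conjunct2, rule_format]
    have "g k \<noteq> 0" for k using g'(2)[of k] by force
    then have orth_g: "sobolev_inner V lam (g m) q = 0" if "degree q < m" for q
      by (intro sobolev_inner_orthogonal_to_basis[OF V _ _ that, of g]) (simp_all add: g'(1) g'(3))
    show "g m = f m"
      by (rule monic_sobolev_orthogonal_unique[OF V lam g'(1) g'(2) orth_g f(1) f(2) f(3)])
  qed
  have "sobolev_poly V lam = f" 
    unfolding sobolev_poly_def by (rule the_equality[of "is_sobolev_orthogonal V lam" f, OF orth uniq])
  then show ?thesis
    using monic_sobolev_orthogonal_unique[OF V lam f(1) f(2) f(3) p] by simp
qed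

section \<open>The moment problem\<close>

locale sibuya_system =
  fixes V :: "real poly" and D :: nat and lam rho :: real
    and phi psi :: "complex \<Rightarrow> complex" and F :: "nat \<Rightarrow> complex \<Rightarrow> complex"
  assumes evenD: "even D" and D4: "D \<ge> 4" and lam: "lam > 0"
    and degV: "degree V = D" and leadV: "lead_coeff V > 0"
    and coords: "root_coordinates V rho phi psi"
    and sibuya: "\<And>k. k < 2 * D \<Longrightarrow> is_sibuya_solution V lam rho psi k (F k)"
begin

definition ray_dir :: "nat \<Rightarrow> complex" where
  "ray_dir m = cis (pi * real (2 * m) / real D)"

definition phase :: "nat \<Rightarrow> complex" where
  "phase m = \<i> ^ (2 * m) * cis (- pi / 4)"

text \<open>
  The functionals of the moment problem are extended from the monomials to all polynomials, so that they
  can be applied to the image of \<open>L\<close>.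
\<close>
definition ray_functional :: "nat \<Rightarrow> complex poly \<Rightarrow> complex" where
  "ray_functional m p = ray_integral D (2 * m) (\<lambda>z. sibuya_Y V lam F (2 * m) z * exp (- poly (cpoly V) z / 2) * poly p z)"

text \<open>
  The expression in braces that the constant \<open>c j\<close> multiplies; \<open>Y\<^sub>D\<close> has index \<open>2 * (D div 2)\<close>.
\<close>
definition loop_functional :: "nat \<Rightarrow> complex poly \<Rightarrow> complex" where
  "loop_functional j p = ray_functional j p - sibuya_beta V lam F j * ray_functional 0 p
     - sibuya_kappa V lam F j * ray_functional (D div 2) p"

definition line_functional :: "complex poly \<Rightarrow> complex poly \<Rightarrow> complex" where
  "line_functional P p = (LBINT x. poly p (complex_of_real x) * poly P (complex_of_real x) * complex_of_real (exp (- poly V x)))"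

lemma V_props: "degree V = D" "D \<ge> 2" "lead_coeff V > 0"
  using degV D4 leadV by auto

lemma phase_nonzero: "phase m \<noteq> 0"
  by (simp add: phase_def)

lemma norm_ray_dir: "norm (ray_dir m) = 1"
  by (simp add: ray_dir_def)

lemma ray_dir_power: "ray_dir m ^ D = 1"
proof -
  have "real D * (pi * real (2 * m) / real D) = 2 * pi * real m" using D4 by simp
  then show ?thesis unfolding ray_dir_def Complex.DeMoivre
    by (simp add: cis_multiple_2pi)
qed

lemma inj_ray_dir: "inj_on ray_dir {..<D}"
proof -
  have "ray_dir = (\<lambda>m. exp (2 * complex_of_real pi * \<i> * complex_of_nat m / complex_of_nat D))"
    by (simp add: ray_dir_def fun_eq_iff cis_conv_exp mult_ac)
  then show ?thesis using bij_betw_imp_inj_on[OF bij_betw_roots_unity[of D]] D4 by simp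
qed

lemma F_holomorphic: "m < D \<Longrightarrow> F (2 * m) holomorphic_on UNIV"
  using sibuya[of "2 * m"] by (simp add: is_sibuya_solution_def)

lemma F_ode: "m < D \<Longrightarrow> poly (cpoly (pderiv V)) z * deriv (F (2 * m)) z - deriv (deriv (F (2 * m))) z
     + F (2 * m) z / complex_of_real lam = 0"
  using sibuya[of "2 * m"] by (simp add: is_sibuya_solution_def)

lemma F_tendsto: "m < D \<Longrightarrow> ((\<lambda>t. F (2 * m) (complex_of_real t * ray_dir m)) \<longlongrightarrow> 1) at_top"
  unfolding ray_dir_def
  using sibuya_solution_on_ray(1)[OF coords degV _ sibuya[of "2 * m"]] D4 by simp

lemma F_bounded:
  assumes "m < D"
  obtains B where "\<And>t. t \<ge> 0 \<Longrightarrow> norm (F (2 * m) (complex_of_real t * ray_dir m)) \<le> B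
      \<and> norm (deriv (F (2 * m)) (complex_of_real t * ray_dir m)) \<le> B"
  using sibuya_solution_on_ray(2)[OF coords degV _ sibuya[of "2 * m"]] D4 assms
  unfolding ray_dir_def by fastforce

lemma F_continuous_on_ray: "m < D \<Longrightarrow> continuous_on A (\<lambda>t. F (2 * m) (complex_of_real t * ray_dir m))"
  by (intro continuous_on_compose2[OF holomorphic_on_imp_continuous_on[OF F_holomorphic]] continuous_intros) auto

lemma sibuya_Y_even: "sibuya_Y V lam F (2 * m) = (\<lambda>z. phase m * exp (- poly (cpoly V) z / 2) * F (2 * m) z)"
  by (simp add: sibuya_Y_def phase_def fun_eq_iff)

lemma ray_functional_eq:
  "ray_functional m p = phase m * ray_integral D (2 * m) (\<lambda>z. exp (- poly (cpoly V) z) * F (2 * m) z * poly p z)"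
proof -
  have "exp (- poly (cpoly V) z / 2) * exp (- poly (cpoly V) z / 2) = exp (- poly (cpoly V) z)" for z
    by (simp flip: exp_add)
  then have "sibuya_Y V lam F (2 * m) z * exp (- poly (cpoly V) z / 2) * poly p z
      = phase m * (exp (- poly (cpoly V) z) * F (2 * m) z * poly p z)" for z
    by (simp add: sibuya_Y_even)
  then show ?thesis
    unfolding ray_functional_def ray_integral_def by (simp only: mult.assoc set_integral_mult_right)
qed

lemma ray_functional_eq':
  "ray_functional m p = phase m * ray_dir m * (LBINT t:{0..}. exp (- poly (cpoly V) (complex_of_real t * ray_dir m))
      * F (2 * m) (complex_of_real t * ray_dir m) * poly p (complex_of_real t * ray_dir m))"
  unfolding ray_functional_eq ray_integral_def ray_dir_def[symmetric] set_integral_mult_left by simp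

lemma ray_integrable:
  assumes "m < D"
  shows "set_integrable lborel {0..} (\<lambda>t. exp (- poly (cpoly V) (complex_of_real t * ray_dir m))
      * F (2 * m) (complex_of_real t * ray_dir m) * poly p (complex_of_real t * ray_dir m))"
proof -
  obtain B where B: "\<And>t. t \<ge> 0 \<Longrightarrow> norm (F (2 * m) (complex_of_real t * ray_dir m)) \<le> B
      \<and> norm (deriv (F (2 * m)) (complex_of_real t * ray_dir m)) \<le> B"
    using F_bounded[OF assms] by blast
  have B0: "B \<ge> 0" using order_trans[OF norm_ge_zero conjunct1[OF B[of 0]]] by simp
  obtain C where C: "C \<ge> 0" "\<And>t. t \<ge> 0 \<Longrightarrow> norm (exp (- poly (cpoly V) (complex_of_real t * ray_dir m)))
           * norm (poly p (complex_of_real t * ray_dir m)) \<le> C * exp (- t)"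
    using weight_times_poly_decay_on_ray[OF V_props norm_ray_dir ray_dir_power] by blast
  show ?thesis
  proof (rule set_integrable_exp_decay[where C = "B * C"])
    show "continuous_on {0..} (\<lambda>t. exp (- poly (cpoly V) (complex_of_real t * ray_dir m))
      * F (2 * m) (complex_of_real t * ray_dir m) * poly p (complex_of_real t * ray_dir m))"
      by (intro continuous_intros F_continuous_on_ray assms)
    fix t :: real assume t: "t \<ge> 0"
    show "norm (exp (- poly (cpoly V) (complex_of_real t * ray_dir m))
      * F (2 * m) (complex_of_real t * ray_dir m) * poly p (complex_of_real t * ray_dir m)) \<le> B * C * exp (- t)"
      using mult_mono[OF conjunct1[OF B[OF t]] C(2)[OF t] B0] by (simp add: norm_mult mult_ac)
  qed
qed

lemma ray_functional_add: "m < D \<Longrightarrow> ray_functional m (p + q) = ray_functional m p + ray_functional m q"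
  using ray_integrable[of m p] ray_integrable[of m q]
  by (simp add: ray_functional_eq' distrib_left set_integral_add(2))

lemma ray_functional_smult: "ray_functional m (smult c p) = c * ray_functional m p"
  unfolding ray_functional_eq' poly_smult mult.left_commute[of _ c] set_integral_mult_right by (rule refl)

lemma coeff_indices_less: "j \<in> coeff_indices D \<Longrightarrow> j < D"
  using D4 by (auto simp: coeff_indices_def)

lemma loop_functional_add: "j \<in> coeff_indices D \<Longrightarrow> loop_functional j (p + q) = loop_functional j p + loop_functional j q"
  using coeff_indices_less[of j] D4 by (simp add: loop_functional_def ray_functional_add algebra_simps)

lemma loop_functional_smult: "loop_functional j (smult c p) = c * loop_functional j p"
  by (simp add: loop_functional_def ray_functional_smult algebra_simps)

lemma sibuya_Y_at_0: "sibuya_Y V lam F (2 * m) 0 = phase m * exp (- poly (cpoly V) 0 / 2) * F (2 * m) 0"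
  by (simp add: sibuya_Y_even)

lemma deriv_sibuya_Y_at_0:
  assumes "m < D"
  shows "deriv (sibuya_Y V lam F (2 * m)) 0 = phase m * exp (- poly (cpoly V) 0 / 2)
     * (deriv (F (2 * m)) 0 - poly (pderiv (cpoly V)) 0 / 2 * F (2 * m) 0)"
proof (rule DERIV_imp_deriv)
  have dF: "(F (2 * m) has_field_derivative deriv (F (2 * m)) 0) (at 0)"
    using F_holomorphic[OF assms] by (intro holomorphic_derivI[of _ UNIV]) auto
  have product_rule: "((\<lambda>z. phase m * exp (- poly (cpoly V) z / 2) * f z) has_field_derivative phase m * exp (- poly (cpoly V) 0 / 2)
     * (f' - poly (pderiv (cpoly V)) 0 / 2 * f 0)) (at 0)" if "(f has_field_derivative f') (at 0)" for f f'
    by (auto intro!: derivative_eq_intros that poly_DERIV simp: algebra_simps)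
  show "(sibuya_Y V lam F (2 * m) has_field_derivative phase m * exp (- poly (cpoly V) 0 / 2)
     * (deriv (F (2 * m)) 0 - poly (pderiv (cpoly V)) 0 / 2 * F (2 * m) 0)) (at 0)"
    unfolding sibuya_Y_even by (rule product_rule[OF dF])
qed

text \<open>
  Written through \<open>Y\<close> instead of \<open>F\<close>, the boundary term is the same linear form in \<open>(Y 0, Y' 0)\<close> for every
  ray. This is what makes cancellation between the rays possible.
\<close>
lemma ray_functional_sobolev_op:
  assumes "m < D"
  shows "ray_functional m (sobolev_op (cpoly V) (complex_of_real lam) Q)
    = complex_of_real lam * exp (- poly (cpoly V) 0 / 2)
      * ((poly (pderiv Q) 0 - poly (pderiv (cpoly V)) 0 / 2 * poly Q 0) * sibuya_Y V lam F (2 * m) 0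
         - poly Q 0 * deriv (sibuya_Y V lam F (2 * m)) 0)"
proof -
  let ?e = "exp (- poly (cpoly V) 0 / 2) :: complex"
  obtain B where B: "\<And>t. t \<ge> 0 \<Longrightarrow> norm (F (2 * m) (complex_of_real t * ray_dir m)) \<le> B
      \<and> norm (deriv (F (2 * m)) (complex_of_real t * ray_dir m)) \<le> B"
    using F_bounded[OF assms] by blast
  have "ray_integral D (2 * m) (\<lambda>z. exp (- poly (cpoly V) z) * F (2 * m) z
        * poly (sobolev_op (cpoly V) (complex_of_real lam) Q) z)
      = complex_of_real lam * exp (- poly (cpoly V) 0) * (F (2 * m) 0 * poly (pderiv Q) 0 - deriv (F (2 * m)) 0 * poly Q 0)"
    using ray_integral_sobolev_op[OF V_props ray_dir_power[of m, unfolded ray_dir_def] _ F_holomorphic[OF assms] F_ode[OF assms]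
        B[unfolded ray_dir_def]] lam by simp
  moreover have "exp (- poly (cpoly V) 0) = ?e * ?e" by (simp flip: exp_add)
  ultimately show ?thesis
    unfolding ray_functional_eq sibuya_Y_at_0 deriv_sibuya_Y_at_0[OF assms]
    by (simp only:) (simp only: algebra_simps)
qed

text \<open>
  If the Wronskian vanished at \<open>0\<close>, both solutions would have the same logarithmic derivative there, but
  \<open>deriv_times_cnj_negative\<close> gives real parts of opposite sign.
\<close>
lemma wronskian_nonzero: "wronskian (sibuya_Y V lam F 0) (sibuya_Y V lam F D) 0 \<noteq> 0"
proof
  assume W: "wronskian (sibuya_Y V lam F 0) (sibuya_Y V lam F D) 0 = 0"
  define h where "h = D div 2"
  have h: "D = 2 * h" "h < D" using evenD D4 by (auto simp: h_def)
  have dir0: "ray_dir 0 = 1" by (simp add: ray_dir_def)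
  have dirh: "ray_dir h = -1" using D4 by (simp add: ray_dir_def h(1)[symmetric])
  obtain B0 where B0: "\<And>t. t \<ge> 0 \<Longrightarrow> norm (F (2 * 0) (complex_of_real t * ray_dir 0)) \<le> B0
      \<and> norm (deriv (F (2 * 0)) (complex_of_real t * ray_dir 0)) \<le> B0"
    using F_bounded[of 0] D4 by auto
  obtain B1 where B1: "\<And>t. t \<ge> 0 \<Longrightarrow> norm (F (2 * h) (complex_of_real t * ray_dir h)) \<le> B1
      \<and> norm (deriv (F (2 * h)) (complex_of_real t * ray_dir h)) \<le> B1"
    using F_bounded[of h] h by auto
  have neg: "1 * Re (deriv (F (2 * 0)) 0 * cnj (F (2 * 0) 0)) < 0"
    using B0 F_tendsto[of 0] D4 F_ode[of 0]
    by (intro deriv_times_cnj_negative[OF V_props _ _ lam F_holomorphic, where B = B0]) (auto simp: dir0)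
  have pos: "(-1) * Re (deriv (F (2 * h)) 0 * cnj (F (2 * h) 0)) < 0"
    using B1 F_tendsto[of h] h(2) F_ode[of h] evenD
    by (intro deriv_times_cnj_negative[OF V_props _ _ lam F_holomorphic, where B = B1]) (auto simp: dirh)
  define a a' b b' where "a = F (2 * 0) 0" and "a' = deriv (F (2 * 0)) 0"
    and "b = F (2 * h) 0" and "b' = deriv (F (2 * h)) 0"
  have ab: "Re (a' * cnj a) < 0" "Re (b' * cnj b) > 0" using neg pos by (auto simp: a_def a'_def b_def b'_def)
  have "wronskian (sibuya_Y V lam F (2 * 0)) (sibuya_Y V lam F (2 * h)) 0
      = phase 0 * phase h * exp (- poly (cpoly V) 0 / 2) ^ 2 * (a * b' - a' * b)"
    using D4 h(2) unfolding wronskian_def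
    by (simp only: sibuya_Y_at_0 deriv_sibuya_Y_at_0 a_def a'_def b_def b'_def) (simp add: algebra_simps power2_eq_square)
  then have eq: "a * b' = a' * b" using W h phase_nonzero by simp
  have nz: "a \<noteq> 0" "b \<noteq> 0" using ab by auto
  \<comment> \<open>\<open>a'/a = b'/b\<close>, cleared of denominators\<close>
  have "(a' * cnj a) * complex_of_real (norm b ^ 2) = (b' * cnj b) * complex_of_real (norm a ^ 2)"
    unfolding complex_norm_square using eq by (metis mult.assoc mult.commute)
  then have "Re (a' * cnj a) * norm b ^ 2 = Re (b' * cnj b) * norm a ^ 2"
    by (auto dest!: arg_cong[of _ _ Re])
  moreover have "Re (a' * cnj a) * norm b ^ 2 < 0" "Re (b' * cnj b) * norm a ^ 2 > 0"
    using ab nz by (auto intro: mult_neg_pos)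
  ultimately show False by simp
qed

text \<open>
  Cramer's rule for the expansion of the Cauchy data at \<open>0\<close> in those of \<open>Y\<^sub>0\<close> and \<open>Y\<^sub>D\<close>.
\<close>
lemma sibuya_connection:
  fixes j :: nat
  defines "\<beta> \<equiv> sibuya_beta V lam F j" and "\<kappa> \<equiv> sibuya_kappa V lam F j"
  shows "sibuya_Y V lam F (2 * j) 0 = \<beta> * sibuya_Y V lam F 0 0 + \<kappa> * sibuya_Y V lam F D 0"
    and "deriv (sibuya_Y V lam F (2 * j)) 0 = \<beta> * deriv (sibuya_Y V lam F 0) 0 + \<kappa> * deriv (sibuya_Y V lam F D) 0"
proof -
  define y0 y0' yD yD' yj yj' where "y0 = sibuya_Y V lam F 0 0" and "y0' = deriv (sibuya_Y V lam F 0) 0"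
    and "yD = sibuya_Y V lam F D 0" and "yD' = deriv (sibuya_Y V lam F D) 0"
    and "yj = sibuya_Y V lam F (2 * j) 0" and "yj' = deriv (sibuya_Y V lam F (2 * j)) 0"
  note defs = this
  define w where "w = y0 * yD' - y0' * yD"
  have w: "w \<noteq> 0" using wronskian_nonzero by (simp add: w_def defs wronskian_def)
  have \<beta>: "\<beta> * w = - (yD * yj' - yD' * yj)" and \<kappa>: "\<kappa> * w = y0 * yj' - y0' * yj"
    using w by (simp_all add: \<beta>_def \<kappa>_def sibuya_beta_def sibuya_kappa_def Let_def degV wronskian_def w_def defs)
  have "(\<beta> * y0 + \<kappa> * yD) * w = (\<beta> * w) * y0 + (\<kappa> * w) * yD" by (simp add: algebra_simps)
  also have "\<dots> = yj * w" unfolding \<beta> \<kappa> by (simp add: w_def algebra_simps)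
  finally show "yj = \<beta> * y0 + \<kappa> * yD" using w by simp
  have "(\<beta> * y0' + \<kappa> * yD') * w = (\<beta> * w) * y0' + (\<kappa> * w) * yD'" by (simp add: algebra_simps)
  also have "\<dots> = yj' * w" unfolding \<beta> \<kappa> by (simp add: w_def algebra_simps)
  finally show "yj' = \<beta> * y0' + \<kappa> * yD'" using w by simp
qed

lemma loop_functional_sobolev_op:
  assumes "j \<in> coeff_indices D"
  shows "loop_functional j (sobolev_op (cpoly V) (complex_of_real lam) Q) = 0"
proof -
  have "j < D" "0 < D" "D div 2 < D" "2 * (D div 2) = D" using coeff_indices_less[OF assms] D4 evenD by auto
  then show ?thesis
    unfolding loop_functional_def
    by (simp only: ray_functional_sobolev_op sibuya_connection[of j] mult_0_right) (simp add: algebra_simps)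
qed

lemma coeff_sobolev_op_eq_0:
  "coeff (sobolev_op (cpoly V) (complex_of_real lam) Q) i = 0" if "i > degree Q + (D - 2)"
proof -
  have "degree (pderiv (cpoly V) * pderiv Q) \<le> (D - 1) + (degree Q - 1)"
    by (rule order_trans[OF degree_mult_le]) (simp add: degree_pderiv degV)
  show ?thesis
  proof (cases "degree Q = 0")
    case True
    then have "pderiv Q = 0" by (simp add: pderiv_eq_0_iff)
    then show ?thesis using that by (simp add: sobolev_op_def coeff_eq_0)
  next
    case False
    have "degree (pderiv (cpoly V) * pderiv Q) < i"
      using \<open>degree (pderiv (cpoly V) * pderiv Q) \<le> _\<close> that False D4 by linarith
    moreover have "degree Q < i" "degree (pderiv (pderiv Q)) < i"
      using that by (simp_all add: degree_pderiv)
    ultimately show ?thesis by (simp add: sobolev_op_def coeff_eq_0)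
  qed
qed

lemma degree_sobolev_op:
  assumes "degree Q > 0"
  shows "degree (sobolev_op (cpoly V) (complex_of_real lam) Q) = degree Q + (D - 2)"
proof -
  let ?N = "degree Q + (D - 2)"
  have "degree (pderiv (cpoly V)) = D - 1" "degree (pderiv Q) = degree Q - 1" by (simp_all add: degree_pderiv degV)
  then have "pderiv (cpoly V) \<noteq> 0" "degree (pderiv (cpoly V) * pderiv Q) = ?N" "pderiv (cpoly V) * pderiv Q \<noteq> 0"
    using assms D4 degV by (auto simp: degree_mult_eq pderiv_eq_0_iff)
  then have "coeff (pderiv (cpoly V) * pderiv Q) ?N \<noteq> 0" by (metis leading_coeff_0_iff)
  moreover have "coeff Q ?N = 0" "coeff (pderiv (pderiv Q)) ?N = 0"
    using assms D4 by (auto intro!: coeff_eq_0 simp: degree_pderiv)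
  ultimately have "coeff (sobolev_op (cpoly V) (complex_of_real lam) Q) ?N \<noteq> 0"
    using lam by (simp add: sobolev_op_def)
  then show ?thesis
    using coeff_sobolev_op_eq_0[of Q] by (intro antisym degree_le le_degree) auto
qed

text \<open>
  Vanishing on degrees up to \<open>D - 2\<close> propagates to all polynomials, because the remaining degrees are reached
  by \<open>L\<close>, on whose image the functionals vanish anyway. Then each \<open>c j\<close> is, up to a nonzero factor, the
  coefficient of its own ray in a combination of all \<open>D\<close> ray functionals, where rays \<open>0\<close> and \<open>D div 2\<close> collect the
  contributions of the connection coefficients.
\<close>
lemma loop_functionals_independent:
  assumes zero: "\<And>k. k \<le> D - 2 \<Longrightarrow> (\<Sum>j\<in>coeff_indices D. c j * loop_functional j (monom 1 k)) = 0"
    and j: "j \<in> coeff_indices D"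
  shows "c j = 0"
proof -
  define \<Lambda> where "\<Lambda> = (\<lambda>p. \<Sum>j\<in>coeff_indices D. c j * loop_functional j p)"
  have all0: "\<Lambda> p = 0" for p
  proof (rule linear_functional_vanishes_on_polys)
    let ?b = "\<lambda>k. if k \<le> D - 2 then monom 1 k else sobolev_op (cpoly V) (complex_of_real lam) (monom 1 (k - (D - 2)))"
    show "\<Lambda> (p + q) = \<Lambda> p + \<Lambda> q" for p q
      by (simp add: \<Lambda>_def loop_functional_add distrib_left sum.distrib)
    show "\<Lambda> (smult a p) = a * \<Lambda> p" for a p
      by (simp add: \<Lambda>_def loop_functional_smult sum_distrib_left mult.left_commute[of _ a])
    show "?b m \<noteq> 0 \<and> degree (?b m) = m" for m
    proof (cases "m \<le> D - 2")
      case True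
      then show ?thesis by (simp add: degree_monom_eq)
    next
      case False
      then have "degree (?b m) = m" by (simp add: degree_sobolev_op degree_monom_eq)
      then show ?thesis using False by auto
    qed
    show "\<Lambda> (?b m) = 0" for m
      using zero by (auto simp: \<Lambda>_def loop_functional_sobolev_op)
    show "coeff p i = 0" if "i \<ge> Suc (degree p)" for i using that by (simp add: coeff_eq_0)
  qed
  define h where "h = D div 2"
  have h: "h < D" "h > 0" using D4 by (auto simp: h_def)
  define d where "d = (\<lambda>m. if m = 0 then - (\<Sum>j\<in>coeff_indices D. c j * sibuya_beta V lam F j)
     else if m = h then - (\<Sum>j\<in>coeff_indices D. c j * sibuya_kappa V lam F j) else c m)"
  have fin: "finite (coeff_indices D)" by (simp add: coeff_indices_def)
  have idx: "{..<D} = insert 0 (insert h (coeff_indices D))" "0 \<notin> insert h (coeff_indices D)" "h \<notin> coeff_indices D"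
    using h by (auto simp: coeff_indices_def h_def)
  have split: "(\<Sum>m<D. d m * ray_functional m p) = \<Lambda> p" for p
  proof -
    have "(\<Sum>m\<in>coeff_indices D. d m * ray_functional m p) = (\<Sum>m\<in>coeff_indices D. c m * ray_functional m p)"
      using idx by (intro sum.cong) (auto simp: d_def)
    then have "(\<Sum>m<D. d m * ray_functional m p) = d 0 * ray_functional 0 p + d h * ray_functional h p
        + (\<Sum>m\<in>coeff_indices D. c m * ray_functional m p)"
      using idx fin by simp
    also have "\<dots> = \<Lambda> p"
      using h by (simp add: d_def \<Lambda>_def loop_functional_def h_def algebra_simps sum_subtractf sum.distrib sum_distrib_left sum_distrib_right)
    finally show ?thesis .
  qed
  have "d j * (phase j * ray_dir j) = 0"
  proof (rule star_moments_determine_coefficients[OF V_props, where M = "{..<D}" and \<omega> = ray_dir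
        and f = "\<lambda>m t. F (2 * m) (complex_of_real t * ray_dir m)" and a = "\<lambda>m. d m * (phase m * ray_dir m)"
        and B = "\<lambda>m. SOME B. \<forall>t\<ge>0. norm (F (2 * m) (complex_of_real t * ray_dir m)) \<le> B"])
    show "norm (F (2 * m) (complex_of_real t * ray_dir m)) \<le> (SOME B. \<forall>t\<ge>0. norm (F (2 * m) (complex_of_real t * ray_dir m)) \<le> B)"
      if "m \<in> {..<D}" "t \<ge> 0" for m t
    proof -
      have "\<exists>B. \<forall>t\<ge>0. norm (F (2 * m) (complex_of_real t * ray_dir m)) \<le> B"
        using F_bounded[of m] that by (metis lessThan_iff)
      from someI_ex[OF this] show ?thesis using that by blast
    qed
    show "(\<Sum>m<D. d m * (phase m * ray_dir m) * (LBINT t:{0..}. exp (- poly (cpoly V) (complex_of_real t * ray_dir m))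
        * F (2 * m) (complex_of_real t * ray_dir m) * poly p (complex_of_real t * ray_dir m))) = 0" for p
      using split[of p] all0[of p] by (simp only: ray_functional_eq' mult.assoc)
    show "j \<in> {..<D}" using idx j by blast
  qed (auto simp: norm_ray_dir ray_dir_power inj_ray_dir intro: F_tendsto F_continuous_on_ray)
  moreover have "d j = c j" using j idx by (auto simp: d_def)
  moreover have "ray_dir j \<noteq> 0" using norm_ray_dir[of j] by auto
  ultimately show ?thesis using phase_nonzero by simp
qed

lemma line_integrable: "integrable lborel (\<lambda>x. poly p (complex_of_real x) * poly P (complex_of_real x) * complex_of_real (exp (- poly V x)))"
  using integrable_poly_times_weight[OF V_props evenD, of "p * P"] by simp

lemma line_functional_add: "line_functional P (p + q) = line_functional P p + line_functional P q"
  using line_integrable by (simp add: line_functional_def distrib_right)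

lemma line_functional_smult: "line_functional P (smult c p) = c * line_functional P p"
  by (simp add: line_functional_def mult.assoc)

lemma line_functional_commute: "line_functional P p = line_functional p P"
  by (simp add: line_functional_def mult.commute)

lemma complex_poly_Re_Im: "P = cpoly (map_poly Re P) + smult \<i> (cpoly (map_poly Im P))"
  by (simp add: poly_eq_iff coeff_map_poly complex_eq)

text \<open>
  The Sobolev product is defined for real polynomials; complex ones are treated through the polynomials of real
  and imaginary parts of the coefficients.
\<close>
lemma line_functional_sobolev_op:
  "line_functional P (cpoly (sobolev_op V lam q))
     = Complex (sobolev_inner V lam (map_poly Re P) q) (sobolev_inner V lam (map_poly Im P) q)"
proof -
  have real: "line_functional (cpoly p) (cpoly (sobolev_op V lam q)) = complex_of_real (sobolev_inner V lam p q)" for p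
  proof -
    have "line_functional (cpoly p) (cpoly (sobolev_op V lam q))
        = (LBINT x. complex_of_real (poly p x * poly (sobolev_op V lam q) x * exp (- poly V x)))"
      by (simp add: line_functional_def mult.commute)
    then show ?thesis
      by (simp only: integral_complex_of_real sobolev_inner_eq_integral_sobolev_op[OF V_props evenD])
  qed
  have "line_functional P r = line_functional (cpoly (map_poly Re P)) r + \<i> * line_functional (cpoly (map_poly Im P)) r" for r
    by (subst complex_poly_Re_Im[of P])
      (simp only: line_functional_commute[of _ r] line_functional_add line_functional_smult)
  then show ?thesis by (simp add: real complex_eq_iff)
qed

definition moment_functional :: "complex poly \<Rightarrow> (nat \<Rightarrow> complex) \<Rightarrow> complex poly \<Rightarrow> complex" where
  "moment_functional P c p = line_functional P p + (\<Sum>j\<in>coeff_indices D. c j * loop_functional j p)"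

lemma solves_moment_problem_iff:
  "solves_moment_problem V lam F n P c \<longleftrightarrow> degree P = n \<and> lead_coeff P = 1 \<and> c \<in> coeff_indices D \<rightarrow>\<^sub>E UNIV
     \<and> (\<forall>k\<le>n + D - 3. moment_functional P c (monom 1 k) = 0)"
proof -
  have "2 * (D div 2) = D" using evenD by simp
  then show ?thesis
    by (simp add: solves_moment_problem_def Let_def degV moment_functional_def line_functional_def
        loop_functional_def ray_functional_def poly_monom)
qed

text \<open>
  \<open>L q\<close> has degree at most \<open>n + D - 3\<close> if \<open>degree q < n\<close>, so it may be used as test polynomial, and on it only
  the integral over the real line survives.
\<close>
lemma moment_functional_sobolev_orthogonal:
  assumes zero: "\<And>k. k \<le> n + D - 3 \<Longrightarrow> moment_functional P c (monom 1 k) = 0"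
    and q: "degree q < n"
  shows "sobolev_inner V lam (map_poly Re P) q = 0" "sobolev_inner V lam (map_poly Im P) q = 0"
proof -
  have "moment_functional P c (cpoly (sobolev_op V lam q)) = 0"
  proof (rule linear_functional_vanishes_on_polys[where b = "monom 1" and n = "n + D - 2"])
    show "moment_functional P c (p + r) = moment_functional P c p + moment_functional P c r" for p r
      by (simp add: moment_functional_def line_functional_add loop_functional_add distrib_left sum.distrib)
    show "moment_functional P c (smult a p) = a * moment_functional P c p" for a p
      by (simp add: moment_functional_def line_functional_smult loop_functional_smult sum_distrib_left
          mult.left_commute[of _ a] distrib_left)
    show "monom 1 m \<noteq> (0 :: complex poly) \<and> degree (monom 1 m :: complex poly) = m" for m
      by (simp add: degree_monom_eq)
    show "moment_functional P c (monom 1 m) = 0" if "m < n + D - 2" for m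
      using that D4 by (intro zero) linarith
    show "coeff (cpoly (sobolev_op V lam q)) i = 0" if "i \<ge> n + D - 2" for i
      unfolding cpoly_sobolev_op using that q D4 by (intro coeff_sobolev_op_eq_0) simp
  qed
  then have "line_functional P (cpoly (sobolev_op V lam q)) = 0"
    by (simp add: moment_functional_def cpoly_sobolev_op loop_functional_sobolev_op)
  then show "sobolev_inner V lam (map_poly Re P) q = 0" "sobolev_inner V lam (map_poly Im P) q = 0"
    by (simp_all add: line_functional_sobolev_op complex_eq_iff)
qed

lemma coeff_zero_imp_degree_less:
  fixes p :: "'a::zero poly"
  assumes "\<And>i. i \<ge> n \<Longrightarrow> coeff p i = 0" "n > 0"
  shows "degree p < n"
  using assms by (metis degree_0 leading_coeff_0_iff not_le)

lemma moment_functional_injective: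
  assumes n: "n \<ge> 1" and deg: "\<And>i. i \<ge> n \<Longrightarrow> coeff P i = 0"
    and zero: "\<And>k. k \<le> n + D - 3 \<Longrightarrow> moment_functional P c (monom 1 k) = 0"
  shows "P = 0" "\<forall>j\<in>coeff_indices D. c j = 0"
proof -
  note orth = moment_functional_sobolev_orthogonal[OF zero]
  have "degree (map_poly Re P) < n" "degree (map_poly Im P) < n"
    using n deg by (auto intro!: coeff_zero_imp_degree_less simp: coeff_map_poly)
  then have "map_poly Re P = 0" "map_poly Im P = 0"
    using orth sobolev_inner_definite[OF V_props evenD lam] by blast+
  then show "P = 0" using complex_poly_Re_Im[of P] by simp
  then have "line_functional P p = 0" for p by (simp add: line_functional_def)
  then have "(\<Sum>j\<in>coeff_indices D. c j * loop_functional j (monom 1 k)) = 0" if "k \<le> D - 2" for k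
    using zero[of k] that n by (simp add: moment_functional_def)
  then show "\<forall>j\<in>coeff_indices D. c j = 0" using loop_functionals_independent by blast
qed

lemma moment_functional_linear:
  "moment_functional (P + smult a P') (\<lambda>j. c j + a * c' j) p = moment_functional P c p + a * moment_functional P' c' p"
  by (simp add: moment_functional_def line_functional_commute[of _ p] line_functional_add line_functional_smult
      algebra_simps sum.distrib sum_distrib_left)

lemma moment_problem_unique:
  assumes n: "n \<ge> 1" and s: "solves_moment_problem V lam F n P c" and s': "solves_moment_problem V lam F n P' c'"
  shows "P = P'" "c = c'"
proof -
  have *: "degree P = n" "lead_coeff P = 1" "degree P' = n" "lead_coeff P' = 1"
      "c \<in> coeff_indices D \<rightarrow>\<^sub>E UNIV" "c' \<in> coeff_indices D \<rightarrow>\<^sub>E UNIV"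
      "\<And>k. k \<le> n + D - 3 \<Longrightarrow> moment_functional P c (monom 1 k) = 0"
      "\<And>k. k \<le> n + D - 3 \<Longrightarrow> moment_functional P' c' (monom 1 k) = 0"
    using s s' by (auto simp: solves_moment_problem_iff)
  have "coeff (P + smult (-1) P') i = 0" if "i \<ge> n" for i
    using *(1-4) that by (cases "i = n") (auto simp: coeff_eq_0)
  moreover have "moment_functional (P + smult (-1) P') (\<lambda>j. c j + (-1) * c' j) (monom 1 k) = 0" if "k \<le> n + D - 3" for k
    unfolding moment_functional_linear using *(7,8) that by simp
  ultimately have "P + smult (-1) P' = 0" "\<forall>j\<in>coeff_indices D. c j + (-1) * c' j = 0"
    using moment_functional_injective[OF n] by blast+
  then show "P = P'" "c = c'"
    using *(5,6) by (auto intro: PiE_ext)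
qed

text \<open>
  The unknowns are the \<open>n\<close> lower coefficients of \<open>P\<close> and the \<open>D - 2\<close> constants, indexed by a disjoint sum, and
  there are \<open>n + D - 2\<close> equations.
\<close>
lemma moment_problem_solvable:
  assumes n: "n \<ge> 1"
  shows "\<exists>P c. solves_moment_problem V lam F n P c"
proof -
  let ?I = "{..<n} <+> coeff_indices D" and ?K = "{..n + D - 3}"
  define poly_of where "poly_of = (\<lambda>x :: nat + nat \<Rightarrow> complex. \<Sum>i<n. monom (x (Inl i)) i)"
  define A where "A = (\<lambda>k. case_sum (\<lambda>i. line_functional (monom 1 i) (monom 1 k)) (\<lambda>j. loop_functional j (monom 1 k)))"
  have fin: "finite (coeff_indices D)" by (simp add: coeff_indices_def)
  have coeff_P: "coeff (poly_of x) i = (if i < n then x (Inl i) else 0)" for x i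
    by (simp add: poly_of_def coeff_sum sum.delta')
  have line_P: "line_functional (poly_of x) p = (\<Sum>i<n. line_functional (monom 1 i) p * x (Inl i))" for x p
  proof -
    have "line_functional (\<Sum>i<m. monom (x (Inl i)) i) p = (\<Sum>i<m. line_functional (monom 1 i) p * x (Inl i))" for m
    proof (induction m)
      case 0
      then show ?case by (simp add: line_functional_def)
    next
      case (Suc m)
      have "monom (x (Inl m)) m = smult (x (Inl m)) (monom 1 m)" by (simp add: smult_monom)
      then show ?case using Suc
        by (simp add: line_functional_commute[of _ p] line_functional_add line_functional_smult)
    qed
    then show ?thesis by (simp add: poly_of_def)
  qed
  have sum_A: "(\<Sum>i\<in>?I. A k i * x i) = moment_functional (poly_of x) (\<lambda>j. x (Inr j)) (monom 1 k)" for k x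
    using fin by (simp add: sum.Plus A_def moment_functional_def line_P mult.commute)
  have "\<exists>x. \<forall>k\<in>?K. (\<Sum>i\<in>?I. A k i * x i) = - line_functional (monom 1 n) (monom 1 k)"
  proof (rule square_system_solvable)
    have "D div 2 \<in> {1..D - 1}" using D4 by auto
    then have "card (coeff_indices D) = D - 2"
      by (simp add: coeff_indices_def card_Diff_singleton)
    then show "card ?K = card ?I" using fin D4 n by (simp add: card_Plus)
    show "finite ?I" using fin by simp
    fix x assume *: "\<forall>k\<in>?K. (\<Sum>i\<in>?I. A k i * x i) = 0"
    have zero: "moment_functional (poly_of x) (\<lambda>j. x (Inr j)) (monom 1 k) = 0" if "k \<le> n + D - 3" for k
      using bspec[OF *, of k] that unfolding sum_A by simp
    have high: "coeff (poly_of x) i = 0" if "i \<ge> n" for i using that by (simp add: coeff_P)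
    have "poly_of x = 0" by (rule moment_functional_injective(1)[OF n high zero])
    then have "x (Inl i) = 0" if "i < n" for i using coeff_P[of x i] that by simp
    moreover have "\<forall>j\<in>coeff_indices D. x (Inr j) = 0" by (rule moment_functional_injective(2)[OF n high zero])
    ultimately show "\<forall>i\<in>?I. x i = 0" by auto
  qed simp
  then obtain x where x: "\<And>k. k \<le> n + D - 3 \<Longrightarrow>
      moment_functional (poly_of x) (\<lambda>j. x (Inr j)) (monom 1 k) = - line_functional (monom 1 n) (monom 1 k)"
    by (auto simp: sum_A)
  define P where "P = poly_of x + monom 1 n"
  define c where "c = restrict (\<lambda>j. x (Inr j)) (coeff_indices D)"
  have "coeff P n = 1" "\<And>i. i > n \<Longrightarrow> coeff P i = 0" by (auto simp: P_def coeff_P)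
  then have deg: "degree P = n" by (metis degree_le le_antisym le_degree zero_neq_one)
  have "moment_functional P c (monom 1 k) = 0" if "k \<le> n + D - 3" for k
  proof -
    have "moment_functional P c (monom 1 k) = moment_functional (poly_of x) (\<lambda>j. x (Inr j)) (monom 1 k) + line_functional (monom 1 n) (monom 1 k)"
      by (simp add: moment_functional_def P_def c_def line_functional_commute[of _ "monom 1 k"] line_functional_add)
    then show ?thesis using x[OF that] by simp
  qed
  then have "solves_moment_problem V lam F n P c"
    using deg \<open>coeff P n = 1\<close> by (simp add: solves_moment_problem_iff c_def)
  then show ?thesis by blast
qed

lemma moment_problem_solution_is_sobolev_poly:
  assumes n: "n \<ge> 1" and s: "solves_moment_problem V lam F n P c"
  shows "P = cpoly (sobolev_poly V lam n)"
proof -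
  have deg: "degree P = n" "lead_coeff P = 1"
    and zero: "\<And>k. k \<le> n + D - 3 \<Longrightarrow> moment_functional P c (monom 1 k) = 0"
    using s by (auto simp: solves_moment_problem_iff)
  note orth = moment_functional_sobolev_orthogonal[OF zero]
  have "coeff (map_poly Im P) i = 0" if "i \<ge> n" for i
    using deg that by (cases "i = n") (auto simp: coeff_map_poly coeff_eq_0)
  then have "degree (map_poly Im P) < n" using n by (intro coeff_zero_imp_degree_less) auto
  then have Im0: "map_poly Im P = 0" using orth(2) sobolev_inner_definite[OF V_props evenD lam] by blast
  have "coeff (map_poly Re P) n = 1" "\<And>i. i > n \<Longrightarrow> coeff (map_poly Re P) i = 0"
    using deg by (auto simp: coeff_map_poly coeff_eq_0)
  then have "degree (map_poly Re P) = n" "lead_coeff (map_poly Re P) = 1"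
    by (metis degree_le le_antisym le_degree zero_neq_one)+
  then have "sobolev_poly V lam n = map_poly Re P"
    using orth(1) by (intro sobolev_poly_characterization[OF V_props evenD lam]) auto
  then show ?thesis using complex_poly_Re_Im[of P] Im0 by simp
qed

end

theorem corollary2p31:
  fixes D n :: nat and \<gamma> lam rho :: real and V :: "real poly"
    and phi psi :: "complex \<Rightarrow> complex" and F :: "nat \<Rightarrow> complex \<Rightarrow> complex"
  assumes "even D" and "D \<ge> 4" and "lam > 0"
    and "degree V = D" and "lead_coeff V = \<gamma>" and "\<gamma> > 0"
    and "root_coordinates V rho phi psi"
    and "\<forall>k<2 * D. is_sibuya_solution V lam rho psi k (F k)"
    and "n \<ge> 1"
  shows "(\<exists>!(P, c). solves_moment_problem V lam F n P c) \<and>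
         (\<forall>P c. solves_moment_problem V lam F n P c \<longrightarrow> P = cpoly (sobolev_poly V lam n))"
proof -
  have lead: "lead_coeff V > 0" and sib: "\<And>k. k < 2 * D \<Longrightarrow> is_sibuya_solution V lam rho psi k (F k)"
    using assms by auto
  interpret sibuya_system V D lam rho phi psi F
    using assms lead sib by unfold_locales auto
  obtain P c where s: "solves_moment_problem V lam F n P c"
    using moment_problem_solvable[OF assms(9)] by blast
  have uniq: "P' = P \<and> c' = c" if "solves_moment_problem V lam F n P' c'" for P' c'
    using moment_problem_unique[OF assms(9) that s] by blast
  have "\<exists>!(P, c). solves_moment_problem V lam F n P c"
  proof (rule ex1I[of _ "(P, c)"])
    fix q assume "case q of (P, c) \<Rightarrow> solves_moment_problem V lam F n P c"
    then show "q = (P, c)" using uniq by (cases q) simp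
  qed (simp add: s)
  moreover have "\<forall>P c. solves_moment_problem V lam F n P c \<longrightarrow> P = cpoly (sobolev_poly V lam n)"
    using moment_problem_solution_is_sobolev_poly[OF assms(9)] by blast
  ultimately show ?thesis by blast
qed

end
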